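(* Let $\frac32\le q<\infty$, let $A:\ell^q(\mathbb N)\to\ell^2(\mathbb N)$ be the diagonal operator $Ae_n=\lambda_ne_n$ and $\mathcal R=\frac1q\|\cdot\|_{\ell^q}^q$. There is a threshold $\bar c=\bar c(q)>0$ such that the following holds. Let $x^\dagger$ satisfy the source condition: there is $w\in\ell^2(\mathbb N)$ with $\xi:=A^*w\in\partial\mathcal R(x^\dagger)$. For noisy data $y^\delta$ with $\|y^\delta-y\|\le\delta$, let $\alpha_*=\alpha_*(y^\delta)$ be selected by the symmetric quasi-optimality rule, i.e. as a minimiser over $(0,\alpha_{\max})$ of $\psi_{\rm SQO}(\alpha,y^\delta)=D^{\rm sym}_{\xi^{II}_{\alpha,\delta},\xi^\delta_\alpha}(x^{II}_{\alpha,\delta},x^\delta_\alpha)$, and suppose $\delta^*:=\|Ax^\delta_{\alpha_*}-y^\delta\|\ne0$. Suppose that there are constants $0<C_1\le\bar c$ (i.e. $C_1$ sufficiently small) and $C_2,C_3>0$ such that for all noisy data $y^\delta$ and all $\alpha\in(0,\alpha_{\max})$, with $m_n:=\max\{|y_n|,|y_n^\delta|\}$, $$\sum_{\{n:\frac{\lambda_n^q}{\alpha}m_n^{2-q}\ge C_1\}}|\Delta y_n|^2m_n^{q-2}\frac{\alpha}{\lambda_n^q}+\sum_{\{n:\frac{\lambda_n^q}{\alpha}m_n^{2-q}\le C_1\}\cap I_2^c}|\Delta y_n|^2\ \le\ C_2\sum_{\{n:\frac{\lambda_n^q}{\alpha}m_n^{2-q}<C_1\}\cap I_2}\left[\frac{\lambda_n^q\,m_n^{2-q}}{\alpha}\right]^{\frac1{q-1}}|\Delta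 y_n|^2,$$ where $$I_2=\{n\in\mathbb N:\ |\Delta p_{\alpha,n}-\Delta y_n|\le C_3|\Delta p_{\alpha,n}-\Delta p^{II}_{\alpha,n}|\}.$$ Then $$D_\xi(x^\delta_{\alpha_*},x^\dagger)\to0\qquad\text{as }\delta\to0.$$
   Context: $\{e_n\}_{n\in\mathbb N}$ is the standard basis, and $\{\lambda_n\}$ is a sequence of real numbers, $\lambda_n>0$, monotonically decaying to $0$, such that $A$ is a continuous linear operator from $X=\ell^q(\mathbb N)$ to $Y=\ell^2(\mathbb N)$; $A^*$ is its adjoint $Y\to X^*$. $\alpha_{\max}>0$ is fixed. $y=\{y_n\}\in Y$ is exact data, $y^\delta=\{y_n^\delta\}\in Y$ noisy data given for each $\delta>0$, and $x^\dagger\in X$ is an $\mathcal R$-minimising solution: $Ax^\dagger=y$ and $\mathcal R(x^\dagger)=\min\{\mathcal R(x):Ax=y\}$. For $\eta\in\partial\mathcal R(x_2)$, $D_\eta(x_1,x_2)=\mathcal R(x_1)-\mathcal R(x_2)-\langle\eta,x_1-x_2\rangle_{X^*\times X}$ is the Bregman distance; for $\eta_i\in\partial\mathcal R(x_i)$, $D^{\rm sym}_{\eta_1,\eta_2}(x_1,x_2)=\langle\eta_1-\eta_2,x_1-x_2\rangle$. For $\alpha\in(0,\alpha_{\max})$, $x^\delta_\alpha$ is the minimiser over $x\in X$ of $\frac12\|Ax-y^\delta\|^2+\alpha\mathcal R(x)$, $\xi^\delta_\alpha=-\frac1\alpha A^*(Ax^\delta_\alpha-y^\delta)\in\partial\mathcal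 R(x^\delta_\alpha)$; the second Bregman iterate $x^{II}_{\alpha,\delta}$ is the minimiser of $\frac12\|Ax-y^\delta\|^2+\alpha D_{\xi^\delta_\alpha}(x,x^\delta_\alpha)$, with $\xi^{II}_{\alpha,\delta}=-\frac1\alpha A^*(Ax^{II}_{\alpha,\delta}-y^\delta-(y^\delta-Ax^\delta_\alpha))\in\partial\mathcal R(x^{II}_{\alpha,\delta})$. $x_\alpha$, $x^{II}_\alpha$ are defined in the same way with $y$ replacing $y^\delta$. Componentwise differences: $\Delta y=y-y^\delta$, $\Delta p_\alpha=(y-Ax_\alpha)-(y^\delta-Ax_\alpha^\delta)$, $\Delta p_\alpha^{II}=(y-Ax_\alpha^{II})-(y^\delta-Ax^{II}_{\alpha,\delta})$, with $n$-th components $\Delta y_n$, $\Delta p_{\alpha,n}$, $\Delta p^{II}_{\alpha,n}$. Terms in the sums with $y_n=y_n^\delta=0$ are read as $0$. *)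

theory Defs
  imports "HOL-Analysis.Analysis"
begin

type_synonym rseq = "nat \<Rightarrow> real"

definition lp :: "real \<Rightarrow> rseq set" where
  "lp p = {x. summable (\<lambda>n. \<bar>x n\<bar> powr p)}"

definition lp_norm :: "real \<Rightarrow> rseq \<Rightarrow> real" where
  "lp_norm p x = (\<Sum>n. \<bar>x n\<bar> powr p) powr (1 / p)"

definition l2_inner :: "rseq \<Rightarrow> rseq \<Rightarrow> real" where
  "l2_inner x z = (\<Sum>n. x n * z n)"

definition std_basis :: "nat \<Rightarrow> rseq" where
  "std_basis n = (\<lambda>k. if k = n then 1 else 0)"

definition bounded_operator :: "real \<Rightarrow> (rseq \<Rightarrow> rseq) \<Rightarrow> bool" where
  "bounded_operator q A \<longleftrightarrow>
     A ` lp q \<subseteq> lp 2 \<and>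
     (\<forall>a b. \<forall>x\<in>lp q. \<forall>z\<in>lp q.
        A (\<lambda>n. a * x n + b * z n) = (\<lambda>n. a * A x n + b * A z n)) \<and>
     (\<exists>K. \<forall>x\<in>lp q. lp_norm 2 (A x) \<le> K * lp_norm q x)"

text \<open>Elements of the dual of the sequence space are represented as functionals on all real
  sequences, of which only the values on the space itself matter. Accordingly the duality
  pairing of \<open>\<eta>\<close> and \<open>x\<close> is the application \<open>\<eta> x\<close>.\<close>

definition lp_dual :: "real \<Rightarrow> (rseq \<Rightarrow> real) set" where
  "lp_dual q = {\<eta>.
     (\<forall>a b. \<forall>x\<in>lp q. \<forall>z\<in>lp q. \<eta> (\<lambda>n. a * x n + b * z n) = a * \<eta> x + b * \<eta> z) \<and>
     (\<exists>K. \<forall>x\<in>lp q. \<bar>\<eta> x\<bar> \<le> K * lp_norm q x)}"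

text \<open>The adjoint maps \<open>l^2\<close>, identified with its dual, into the dual of \<open>l^q\<close>.\<close>

definition adj :: "(rseq \<Rightarrow> rseq) \<Rightarrow> rseq \<Rightarrow> (rseq \<Rightarrow> real)" where
  "adj A w = (\<lambda>x. l2_inner w (A x))"

definition subdifferential :: "real \<Rightarrow> (rseq \<Rightarrow> real) \<Rightarrow> rseq \<Rightarrow> (rseq \<Rightarrow> real) set" where
  "subdifferential q F x =
     {\<eta> \<in> lp_dual q. \<forall>z\<in>lp q. F x + \<eta> (\<lambda>n. z n - x n) \<le> F z}"

definition Reg :: "real \<Rightarrow> rseq \<Rightarrow> real" where
  "Reg q x = (1 / q) * lp_norm q x powr q"

definition bregman :: "(rseq \<Rightarrow> real) \<Rightarrow> (rseq \<Rightarrow> real) \<Rightarrow> rseq \<Rightarrow> rseq \<Rightarrow> real" where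
  "bregman F \<eta> x1 x2 = F x1 - F x2 - \<eta> (\<lambda>n. x1 n - x2 n)"

definition sym_bregman ::
  "(rseq \<Rightarrow> real) \<Rightarrow> (rseq \<Rightarrow> real) \<Rightarrow> rseq \<Rightarrow> rseq \<Rightarrow> real" where
  "sym_bregman \<eta>1 \<eta>2 x1 x2 =
     \<eta>1 (\<lambda>n. x1 n - x2 n) - \<eta>2 (\<lambda>n. x1 n - x2 n)"

definition R_minimising_solution :: "real \<Rightarrow> (rseq \<Rightarrow> rseq) \<Rightarrow> rseq \<Rightarrow> rseq \<Rightarrow> bool" where
  "R_minimising_solution q A y x \<longleftrightarrow> is_arg_min (Reg q) (\<lambda>z. z \<in> lp q \<and> A z = y) x"

text \<open>Below, \<open>v\<close> stands for either the exact or the noisy data. For \<open>q > 1\<close> and \<open>\<alpha> > 0\<close>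
  both functionals are coercive and strictly convex, so that the definite descriptions
  denote their unique minimisers.\<close>

definition tik_sol :: "real \<Rightarrow> (rseq \<Rightarrow> rseq) \<Rightarrow> rseq \<Rightarrow> real \<Rightarrow> rseq" where
  "tik_sol q A v \<alpha> =
     (THE x. is_arg_min
        (\<lambda>x. 1 / 2 * (lp_norm 2 (\<lambda>n. A x n - v n))\<^sup>2 + \<alpha> * Reg q x)
        (\<lambda>x. x \<in> lp q) x)"

definition tik_dual :: "real \<Rightarrow> (rseq \<Rightarrow> rseq) \<Rightarrow> rseq \<Rightarrow> real \<Rightarrow> (rseq \<Rightarrow> real)" where
  "tik_dual q A v \<alpha> =
     (\<lambda>h. - (1 / \<alpha>) * adj A (\<lambda>n. A (tik_sol q A v \<alpha>) n - v n) h)"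

definition breg_sol :: "real \<Rightarrow> (rseq \<Rightarrow> rseq) \<Rightarrow> rseq \<Rightarrow> real \<Rightarrow> rseq" where
  "breg_sol q A v \<alpha> =
     (THE x. is_arg_min
        (\<lambda>x. 1 / 2 * (lp_norm 2 (\<lambda>n. A x n - v n))\<^sup>2
              + \<alpha> * bregman (Reg q) (tik_dual q A v \<alpha>) x (tik_sol q A v \<alpha>))
        (\<lambda>x. x \<in> lp q) x)"

definition breg_dual :: "real \<Rightarrow> (rseq \<Rightarrow> rseq) \<Rightarrow> rseq \<Rightarrow> real \<Rightarrow> (rseq \<Rightarrow> real)" where
  "breg_dual q A v \<alpha> =
     (\<lambda>h. - (1 / \<alpha>) *
        adj A (\<lambda>n. A (breg_sol q A v \<alpha>) n - v n - (v n - A (tik_sol q A v \<alpha>) n)) h)"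

definition psi_SQO :: "real \<Rightarrow> (rseq \<Rightarrow> rseq) \<Rightarrow> real \<Rightarrow> rseq \<Rightarrow> real" where
  "psi_SQO q A \<alpha> v =
     sym_bregman (breg_dual q A v \<alpha>) (tik_dual q A v \<alpha>) (breg_sol q A v \<alpha>) (tik_sol q A v \<alpha>)"

definition diff_p :: "real \<Rightarrow> (rseq \<Rightarrow> rseq) \<Rightarrow> rseq \<Rightarrow> rseq \<Rightarrow> real \<Rightarrow> rseq" where
  "diff_p q A y yd \<alpha> n =
     (y n - A (tik_sol q A y \<alpha>) n) - (yd n - A (tik_sol q A yd \<alpha>) n)"

definition diff_pII :: "real \<Rightarrow> (rseq \<Rightarrow> rseq) \<Rightarrow> rseq \<Rightarrow> rseq \<Rightarrow> real \<Rightarrow> rseq" where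
  "diff_pII q A y yd \<alpha> n =
     (y n - A (breg_sol q A y \<alpha>) n) - (yd n - A (breg_sol q A yd \<alpha>) n)"

definition I2 :: "real \<Rightarrow> (rseq \<Rightarrow> rseq) \<Rightarrow> rseq \<Rightarrow> rseq \<Rightarrow> real \<Rightarrow> real \<Rightarrow> nat set" where
  "I2 q A y yd \<alpha> C3 =
     {n. \<bar>diff_p q A y yd \<alpha> n - (y n - yd n)\<bar>
           \<le> C3 * \<bar>diff_p q A y yd \<alpha> n - diff_pII q A y yd \<alpha> n\<bar>}"

text \<open>If \<open>y n = yd n = 0\<close>, then every summand below carries the factor \<open>y n - yd n = 0\<close>, so it
  vanishes whatever the value of \<open>0 powr (2 - q)\<close> and whichever index set contains \<open>n\<close>.
  For square summable \<open>y\<close>, \<open>yd\<close> and positive \<open>\<alpha>\<close>, \<open>C1\<close>, \<open>lam n\<close>, and \<open>q > 1\<close>, each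
  summand is bounded on its index set by a multiple of \<open>\<bar>y n - yd n\<bar>\<^sup>2\<close>; hence the
  three sums converge and none of them takes the default value \<open>0\<close>.\<close>

definition noise_condition ::
  "real \<Rightarrow> rseq \<Rightarrow> (rseq \<Rightarrow> rseq) \<Rightarrow> rseq \<Rightarrow> rseq \<Rightarrow> real \<Rightarrow> real \<Rightarrow> real \<Rightarrow> real \<Rightarrow> bool" where
  "noise_condition q lam A y yd \<alpha> C1 C2 C3 \<longleftrightarrow>
    (let m = (\<lambda>n. max \<bar>y n\<bar> \<bar>yd n\<bar>);
         r = (\<lambda>n. lam n powr q / \<alpha> * m n powr (2 - q));
         J = I2 q A y yd \<alpha> C3
     in (\<Sum>\<^sub>\<infinity>n\<in>{n. r n \<ge> C1}. \<bar>y n - yd n\<bar>\<^sup>2 * m n powr (q - 2) * (\<alpha> / lam n powr q))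
          + (\<Sum>\<^sub>\<infinity>n\<in>{n. r n \<le> C1} \<inter> - J. \<bar>y n - yd n\<bar>\<^sup>2)
        \<le> C2 * (\<Sum>\<^sub>\<infinity>n\<in>{n. r n < C1} \<inter> J.
                  (lam n powr q * m n powr (2 - q) / \<alpha>) powr (1 / (q - 1)) * \<bar>y n - yd n\<bar>\<^sup>2))"

end

theory Submission
  imports Defs
begin

text \<open>Since \<open>A\<close> acts as multiplication by \<open>\<lambda>\<close>, everything decouples into scalar problems. With
  \<open>k = q - 1\<close>, \<open>c = \<alpha> / \<lambda>\<^sup>q\<close> and \<open>u = \<lambda> x\<close>, Tikhonov regularisation of the datum \<open>v\<close> solves
  \<open>u + c * spow k u = v\<close>, and the Bregman step solves the same equation with datum \<open>v + (v - u)\<close>.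
  By the source condition the residuals for exact data are at most \<open>\<alpha> * \<bar>w\<bar>\<close>, so that both the
  approximation error and \<open>psi_SQO\<close> at exact data are of order \<open>\<alpha>\<close>.

  The essential point is to bound the data error \<open>(1 / \<alpha>) * (\<Sum>n. \<Delta>p n * \<Delta>u n)\<close> by the sum of
  \<open>psi_SQO\<close> at the exact and at the noisy data. Put \<open>r = m powr (1 - k) / c\<close> where \<open>m\<close> is the larger
  of the two data in absolute value. If \<open>r\<close> is small, then both \<open>\<Delta>p * \<Delta>u\<close> and the summand on the
  right of the noise condition are at most \<open>4 * m\<^sup>2 * r powr (1 / k)\<close>, whereas the summand of
  \<open>psi_SQO\<close> for the datum \<open>m\<close> is at least a multiple of that. If \<open>r\<close> is large, then
  \<open>\<Delta>p * \<Delta>u\<close> is at most a multiple of \<open>\<bar>\<Delta>y\<bar>\<^sup>2 / r\<close>, and the noise condition reduces this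
  case to the first one.

  Comparing with \<open>\<alpha> = \<delta>\<close> shows that \<open>psi_SQO\<close> at the selected parameter tends to \<open>0\<close>. For
  \<open>y \<noteq> 0\<close> this forces the selected parameter to tend to \<open>0\<close>; for \<open>y = 0\<close> we have \<open>w = 0\<close>, and the
  size of the parameter is irrelevant.\<close>

section \<open>The scalar resolvent\<close>

definition spow :: "real \<Rightarrow> real \<Rightarrow> real" where
  "spow k x = sgn x * \<bar>x\<bar> powr k"

lemma spow_0 [simp]: "spow k 0 = 0"
  by (simp add: spow_def)

lemma spow_minus [simp]: "spow k (- x) = - spow k x"
  by (simp add: spow_def sgn_minus)

lemma spow_nonneg_eq: "0 \<le> x \<Longrightarrow> spow k x = x powr k"
  by (cases "x = 0") (auto simp: spow_def)

lemma spow_divide: "0 < c \<Longrightarrow> spow k (x / c) = spow k x / c powr k"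
  by (simp add: spow_def sgn_divide powr_divide abs_divide)

lemma spow_mono:
  assumes "0 < k" "x \<le> y"
  shows "spow k x \<le> spow k y"
proof (cases "0 \<le> x")
  case True
  then show ?thesis using assms by (simp add: spow_nonneg_eq powr_mono2)
next
  case neg: False
  show ?thesis
  proof (cases "0 \<le> y")
    case True
    have "spow k x \<le> 0" using neg by (simp add: spow_def)
    moreover have "0 \<le> spow k y" using True by (simp add: spow_def)
    ultimately show ?thesis by simp
  next
    case False
    have "(- y) powr k \<le> (- x) powr k"
      using assms False by (intro powr_mono2) auto
    then show ?thesis using neg False by (simp add: spow_def)
  qed
qed

lemma spow_inverse: "k \<noteq> 0 \<Longrightarrow> spow k (spow (1 / k) c) = c"
  by (cases "c = 0") (auto simp: spow_def abs_mult powr_powr sgn_mult mult_sgn_abs)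

lemma spow_strict_mono:
  assumes "0 < k" "x < y"
  shows "spow k x < spow k y"
proof -
  have inv: "spow (1 / k) (spow k z) = z" for z
    using spow_inverse[of "1 / k" z] assms by simp
  have "spow k x \<noteq> spow k y"
    using inv[of x] inv[of y] assms(2) by auto
  then show ?thesis using spow_mono[OF assms(1), of x y] assms(2) by simp
qed

lemma spow_monotone_product:
  assumes "0 < k"
  shows "0 \<le> (x - y) * (spow k x - spow k y)"
proof (cases "x \<le> y")
  case True
  with spow_mono[OF assms True] show ?thesis by (intro mult_nonpos_nonpos) auto
next
  case False
  with spow_mono[OF assms, of y x] show ?thesis by (intro mult_nonneg_nonneg) auto
qed

lemma spow_mult_self: "spow k x * x = \<bar>x\<bar> powr (k + 1)"
proof (cases "x = 0")
  case False
  then have "spow k x * x = \<bar>x\<bar> powr k * (sgn x * x)"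
    by (simp add: spow_def)
  also have "sgn x * x = \<bar>x\<bar>"
    by (simp add: sgn_if)
  finally show ?thesis using False by (simp add: powr_add)
qed simp

text \<open>Young's inequality with the conjugate exponent \<open>q / (q - 1)\<close>, applied to
  \<open>\<bar>b\<bar>\<close> and \<open>\<bar>a\<bar> powr (q - 1)\<close>. It is an equality at
  \<open>b = a\<close>, which makes it the tangent inequality.\<close>

lemma powr_subgradient:
  assumes "1 < q"
  shows "\<bar>a\<bar> powr q / q + spow (q - 1) a * (b - a) \<le> \<bar>b\<bar> powr q / q"
proof -
  define p where "p = q / (q - 1)"
  have p: "1 < p" "1 / q + 1 / p = 1"
    using assms by (auto simp: p_def field_simps)
  have "spow (q - 1) a * b \<le> \<bar>b\<bar> * \<bar>a\<bar> powr (q - 1)"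
  proof -
    have "spow (q - 1) a * b \<le> \<bar>spow (q - 1) a * b\<bar>" by simp
    also have "\<dots> \<le> \<bar>b\<bar> * \<bar>a\<bar> powr (q - 1)"
      by (auto simp: spow_def abs_mult abs_sgn_eq)
    finally show ?thesis .
  qed
  also have "\<dots> \<le> \<bar>b\<bar> powr q / q + (\<bar>a\<bar> powr (q - 1)) powr p / p"
    using assms p by (intro Youngs_inequality) auto
  also have "(\<bar>a\<bar> powr (q - 1)) powr p = \<bar>a\<bar> powr q"
    using assms by (simp add: powr_powr p_def)
  finally have "spow (q - 1) a * b \<le> \<bar>b\<bar> powr q / q + \<bar>a\<bar> powr q / p" .
  moreover have "\<bar>a\<bar> powr q / p = \<bar>a\<bar> powr q - \<bar>a\<bar> powr q / q"
    using p assms by (simp add: p_def field_simps)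
  moreover have "spow (q - 1) a * a = \<bar>a\<bar> powr q"
    using spow_mult_self[of "q - 1" a] by simp
  ultimately show ?thesis by (simp add: algebra_simps)
qed

text \<open>A scalar subgradient is unique because \<open>spow (q - 1)\<close> is onto and strictly
  increasing; no derivative is taken.\<close>

lemma powr_subgradient_unique:
  assumes "1 < q" and sub: "\<And>z. \<bar>a\<bar> powr q / q + c * (z - a) \<le> \<bar>z\<bar> powr q / q"
  shows "c = spow (q - 1) a"
proof -
  \<comment> \<open>The test point is the one whose slope is the midpoint of \<open>c\<close> and
    \<open>spow (q - 1) a\<close>. Adding the subgradient inequalities at \<open>a\<close> and at
    \<open>z\<close> then contradicts strict monotonicity unless \<open>z = a\<close>.\<close>
  define z where "z = spow (1 / (q - 1)) ((c + spow (q - 1) a) / 2)"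
  have z: "spow (q - 1) z = (c + spow (q - 1) a) / 2"
    unfolding z_def using assms(1) by (intro spow_inverse) auto
  have "0 \<le> (c - spow (q - 1) z) * (a - z)"
    using sub[of z] powr_subgradient[OF assms(1), of z a] by (simp add: algebra_simps)
  moreover have "c - spow (q - 1) z = spow (q - 1) z - spow (q - 1) a"
    using z by (simp add: field_simps)
  ultimately have "0 \<le> (spow (q - 1) z - spow (q - 1) a) * (a - z)" by simp
  moreover have "(spow (q - 1) z - spow (q - 1) a) * (a - z) < 0" if "z \<noteq> a"
    using that spow_strict_mono[of "q - 1" z a] spow_strict_mono[of "q - 1" a z] assms(1)
    by (cases "z < a") (auto simp: mult_neg_pos mult_pos_neg)
  ultimately have "z = a" by force
  then show ?thesis using z by simp
qed

text \<open>A one-sided mean value estimate. Homogeneity reduces it to \<open>a = 1\<close>; the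
  constant \<open>k + 2\<close> covers slope \<open>1\<close> for \<open>k \<le> 1\<close>, slope
  \<open>k\<close> for \<open>k > 1\<close>, and the bound \<open>2\<close> when \<open>b\<close> is
  negative.\<close>

lemma spow_diff_le:
  assumes k: "0 < k" and a: "0 < a" and b: "\<bar>b\<bar> \<le> a"
  shows "spow k a - spow k b \<le> (k + 2) * a powr (k - 1) * (a - b)"
proof -
  define t where "t = b / a"
  have t: "\<bar>t\<bar> \<le> 1" and bt: "b = a * t"
    using a b by (auto simp: t_def abs_divide)
  have main: "1 - spow k t \<le> (k + 2) * (1 - t)"
  proof (cases "0 \<le> t")
    case True
    have pos: "0 \<le> 1 - t" using t by simp
    show ?thesis
    proof (cases "k \<le> 1")
      case True
      have "t powr 1 \<le> t powr k"
        using \<open>0 \<le> t\<close> t True by (intro powr_mono') auto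
      then have "1 - spow k t \<le> 1 - t"
        using \<open>0 \<le> t\<close> by (simp add: spow_nonneg_eq)
      also have "\<dots> \<le> (k + 2) * (1 - t)"
        using mult_right_mono[of 1 "k + 2" "1 - t"] pos k by simp
      finally show ?thesis .
    next
      case False
      \<comment> \<open>Bernoulli's inequality, as the tangent inequality at
        \<open>1\<close>.\<close>
      have "1 / k + (t - 1) \<le> t powr k / k"
        using powr_subgradient[of k 1 t] False \<open>0 \<le> t\<close> by (simp add: spow_def)
      from mult_left_mono[OF this, of k] have "1 + k * (t - 1) \<le> t powr k"
        using k by (simp add: distrib_left)
      then show ?thesis
        using pos \<open>0 \<le> t\<close> by (simp add: spow_nonneg_eq algebra_simps)
    qed
  next
    case False
    then have "1 - spow k t = 1 + \<bar>t\<bar> powr k" by (simp add: spow_def)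
    also have "\<dots> \<le> 2" using t k False powr_mono2[of k "\<bar>t\<bar>" 1] by simp
    also have "\<dots> \<le> (k + 2) * (1 - t)"
      using False k mult_mono[of 2 "k + 2" 1 "1 - t"] by simp
    finally show ?thesis .
  qed
  have "spow k b = a powr k * spow k t"
    using a by (simp add: bt spow_def sgn_mult abs_mult powr_mult)
  then have "spow k a - spow k b = a powr k * (1 - spow k t)"
    using a by (simp add: spow_nonneg_eq algebra_simps)
  also have "\<dots> \<le> a powr k * ((k + 2) * (1 - t))"
    using main by (intro mult_left_mono) auto
  also have "\<dots> = (k + 2) * a powr (k - 1) * (a - b)"
    using a by (simp add: bt powr_diff field_simps)
  finally show ?thesis .
qed

section \<open>The scalar proximal map of
  \<open>c * \<bar>u\<bar> powr (k + 1) / (k + 1)\<close>\<close>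

definition resolv :: "real \<Rightarrow> real \<Rightarrow> real \<Rightarrow> real" where
  "resolv k c v = (SOME u. u + c * spow k u = v)"

lemma ex_resolv_nonneg:
  assumes "0 < k" "0 < c" "0 \<le> v"
  shows "\<exists>u. u + c * spow k u = v"
proof -
  have "\<exists>u. 0 \<le> u \<and> u \<le> v \<and> u + c * u powr k = v"
  proof (rule IVT')
    show "continuous_on {0..v} (\<lambda>u. u + c * u powr k)"
      using assms by (intro continuous_intros continuous_on_powr') auto
  qed (use assms in auto)
  then show ?thesis using spow_nonneg_eq by metis
qed

lemma resolv_eq:
  assumes "0 < k" "0 < c"
  shows "resolv k c v + c * spow k (resolv k c v) = v"
proof -
  have "\<exists>u. u + c * spow k u = v"
  proof (cases "0 \<le> v")
    case True
    then show ?thesis using ex_resolv_nonneg assms by blast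
  next
    case False
    then obtain u where "u + c * spow k u = - v"
      using ex_resolv_nonneg[of k c "- v"] assms by auto
    then have "(- u) + c * spow k (- u) = v" by simp
    then show ?thesis by blast
  qed
  then show ?thesis unfolding resolv_def by (rule someI_ex)
qed

text \<open>The residual \<open>v - resolv k c v\<close> is \<open>c * spow k\<close> of the
  resolvent, hence a nondecreasing function of it.\<close>

lemma resolvent_monotone:
  assumes "0 < k" "0 < c"
  shows "0 \<le> (resolv k c v - resolv k c v')
              * ((v - resolv k c v) - (v' - resolv k c v'))"
proof -
  let ?u = "resolv k c v" and ?u' = "resolv k c v'"
  have "(v - ?u) - (v' - ?u') = c * (spow k ?u - spow k ?u')"
    using resolv_eq[OF assms, of v] resolv_eq[OF assms, of v'] by (simp add: algebra_simps)
  then have eq: "(?u - ?u') * ((v - ?u) - (v' - ?u')) = c * ((?u - ?u') * (spow k ?u - spow k ?u'))"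
    by simp
  have "0 \<le> c * ((?u - ?u') * (spow k ?u - spow k ?u'))"
    using spow_monotone_product[OF assms(1), of ?u ?u'] assms(2) by (intro mult_nonneg_nonneg[of c]) auto
  then show ?thesis unfolding eq .
qed

lemma abs_le_abs_add:
  fixes a b :: real
  assumes "0 \<le> a * b"
  shows "\<bar>a\<bar> \<le> \<bar>a + b\<bar>"
proof -
  have "\<bar>a\<bar>\<^sup>2 \<le> \<bar>a + b\<bar>\<^sup>2"
    using assms by (simp add: power2_sum)
  then show ?thesis by (rule power2_le_imp_le) simp
qed

text \<open>Firm nonexpansiveness: the change of the datum is the sum of the changes of resolvent
  and residual. Their product is nonnegative, so neither exceeds the sum in absolute value.\<close>

lemma resolvent_lipschitz:
  assumes "0 < k" "0 < c"
  shows "\<bar>resolv k c v - resolv k c v'\<bar> \<le> \<bar>v - v'\<bar>"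
    and "\<bar>(v - resolv k c v) - (v' - resolv k c v')\<bar> \<le> \<bar>v - v'\<bar>"
  using abs_le_abs_add[OF resolvent_monotone[OF assms, of v v']]
    abs_le_abs_add[of "(v - resolv k c v) - (v' - resolv k c v')" "resolv k c v - resolv k c v'"]
    resolvent_monotone[OF assms, of v v']
  by (simp_all add: mult.commute)

lemma resolv_unique:
  assumes "0 < k" "0 < c" "u + c * spow k u = v"
  shows "resolv k c v = u"
proof -
  let ?u = "resolv k c v"
  have "(?u - u) + c * (spow k ?u - spow k u) = 0"
    using resolv_eq[OF assms(1,2), of v] assms(3) by (simp add: algebra_simps)
  then have "?u - u = - (c * (spow k ?u - spow k u))" by simp
  then have "(?u - u) * (?u - u) = - c * ((?u - u) * (spow k ?u - spow k u))"
    by simp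
  also have "\<dots> \<le> 0"
    using spow_monotone_product[OF assms(1), of ?u u] assms(2) by simp
  finally show ?thesis by (auto simp: mult_le_0_iff)
qed

lemma resolv_0 [simp]: "0 < k \<Longrightarrow> 0 < c \<Longrightarrow> resolv k c 0 = 0"
  by (rule resolv_unique) auto

lemma resolv_minus:
  assumes "0 < k" "0 < c"
  shows "resolv k c (- v) = - resolv k c v"
  using assms resolv_eq[OF assms, of v] by (intro resolv_unique) auto

lemma resolv_mono:
  assumes "0 < k" "0 < c" "v \<le> v'"
  shows "resolv k c v \<le> resolv k c v'"
proof (rule ccontr)
  assume "\<not> ?thesis"
  then have lt: "resolv k c v' < resolv k c v" by simp
  then have "resolv k c v' + c * spow k (resolv k c v') < resolv k c v + c * spow k (resolv k c v)"
    using spow_mono[OF assms(1), of "resolv k c v'" "resolv k c v"] assms(2)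
    by (intro add_less_le_mono mult_left_mono) auto
  then show False
    using resolv_eq[OF assms(1,2)] assms(3) by simp
qed

lemma resolv_bounds:
  assumes "0 < k" "0 < c" "0 \<le> v"
  shows "0 \<le> resolv k c v" "resolv k c v \<le> v"
proof -
  show "0 \<le> resolv k c v"
    using resolv_mono[OF assms(1,2), of 0 v] assms by simp
  then show "resolv k c v \<le> v"
    using resolvent_lipschitz(1)[OF assms(1,2), of v 0] assms by simp
qed

lemma abs_resolv:
  assumes "0 < k" "0 < c"
  shows "\<bar>resolv k c v\<bar> = resolv k c \<bar>v\<bar>"
  using resolv_bounds(1)[OF assms, of v] resolv_bounds(1)[OF assms, of "- v"]
    resolv_minus[OF assms, of v]
  by (cases "0 \<le> v") auto

section \<open>Scalar estimates for the quasi-optimality criterion\<close>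

lemma spow_eq_resolv:
  assumes "0 < k" "0 < c"
  shows "c * spow k (resolv k c v) = v - resolv k c v"
  using resolv_eq[OF assms, of v] by simp

definition breg_resolv :: "real \<Rightarrow> real \<Rightarrow> real \<Rightarrow> real" where
  "breg_resolv k c v = resolv k c (v + (v - resolv k c v))"

text \<open>The summand of \<open>\<alpha> * psi_SQO\<close>: the second residual times the increment of the iterates.\<close>

definition quasi_opt :: "real \<Rightarrow> real \<Rightarrow> real \<Rightarrow> real" where
  "quasi_opt k c v = (v - breg_resolv k c v) * (breg_resolv k c v - resolv k c v)"

lemma breg_resolv_minus:
  assumes "0 < k" "0 < c"
  shows "breg_resolv k c (- v) = - breg_resolv k c v"
proof -
  have "- v + (- v - resolv k c (- v)) = - (v + (v - resolv k c v))"
    by (simp add: resolv_minus[OF assms])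
  then show ?thesis unfolding breg_resolv_def by (metis resolv_minus[OF assms])
qed

lemma quasi_opt_minus:
  assumes "0 < k" "0 < c"
  shows "quasi_opt k c (- v) = quasi_opt k c v"
  unfolding quasi_opt_def breg_resolv_minus[OF assms] resolv_minus[OF assms]
  by (simp add: algebra_simps)

lemma quasi_opt_abs:
  assumes "0 < k" "0 < c"
  shows "quasi_opt k c \<bar>v\<bar> = quasi_opt k c v"
  using quasi_opt_minus[OF assms, of v] by (simp add: abs_if)

text \<open>With \<open>u\<close>, \<open>u2\<close> the two iterates, subtracting their equations
  gives \<open>v - u2 = c * (spow k u2 - spow k u)\<close>. The added residual moves
  \<open>u2\<close> above \<open>u\<close>, so this difference is nonnegative.\<close>

lemma breg_resolv_bounds:
  assumes "0 < k" "0 < c" "0 \<le> v"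
  shows "resolv k c v \<le> breg_resolv k c v" "breg_resolv k c v \<le> v"
proof -
  let ?u = "resolv k c v" and ?u2 = "breg_resolv k c v"
  have u: "?u \<le> v" using resolv_bounds[OF assms] by simp
  then show le: "?u \<le> ?u2"
    unfolding breg_resolv_def by (intro resolv_mono[OF assms(1,2)]) simp
  have "c * spow k ?u \<le> c * spow k ?u2"
    using spow_mono[OF assms(1) le] assms(2) by simp
  then show "?u2 \<le> v"
    using spow_eq_resolv[OF assms(1,2), of v]
      spow_eq_resolv[OF assms(1,2), of "v + (v - ?u)", folded breg_resolv_def] by simp
qed

text \<open>For \<open>v \<ge> 0\<close> the first iterate, the second iterate and the datum are
  ordered, so both factors lie between \<open>0\<close> and the first residual. Oddness of the
  iterates settles negative data.\<close>

lemma quasi_opt_bounds: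
  assumes "0 < k" "0 < c"
  shows "0 \<le> quasi_opt k c v" "quasi_opt k c v \<le> (v - resolv k c v)\<^sup>2"
proof -
  have *: "0 \<le> quasi_opt k c v \<and> quasi_opt k c v \<le> (v - resolv k c v)\<^sup>2" if "0 \<le> v" for v
    using breg_resolv_bounds[OF assms that] unfolding quasi_opt_def power2_eq_square
    by (auto intro!: mult_mono mult_nonneg_nonneg)
  have "0 \<le> quasi_opt k c v \<and> quasi_opt k c v \<le> (v - resolv k c v)\<^sup>2"
  proof (cases "0 \<le> v")
    case False
    then have "quasi_opt k c v \<le> (- v - resolv k c (- v))\<^sup>2" "0 \<le> quasi_opt k c v"
      using *[of "- v"] quasi_opt_minus[OF assms, of v] by auto
    moreover have "(- v - resolv k c (- v))\<^sup>2 = (v - resolv k c v)\<^sup>2"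
      by (simp add: resolv_minus[OF assms] power2_eq_square algebra_simps)
    ultimately show ?thesis by simp
  qed (use * in auto)
  then show "0 \<le> quasi_opt k c v" "quasi_opt k c v \<le> (v - resolv k c v)\<^sup>2" by auto
qed

text \<open>Here \<open>r = m powr (1 - k) / c\<close> is the quantity \<open>\<lambda>\<^sup>q m\<^sup>2\<^sup>-\<^sup>q / \<alpha>\<close> of the noise condition.\<close>

lemma resolv_powr_eq:
  assumes "0 < k" "0 < c" "0 < m" and r: "r = m powr (1 - k) / c"
  shows "(resolv k c v / m) powr k * m = r * c * (resolv k c v powr k)"
  using assms by (cases "0 \<le> resolv k c v") (auto simp: powr_divide powr_diff field_simps)

text \<open>In the variable \<open>t = u / m\<close> the equation reads
  \<open>t powr k = r * (1 - t)\<close>, and the right side is at most \<open>r\<close>.\<close>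

lemma resolv_le_powr:
  assumes k: "0 < k" and c: "0 < c" and m: "0 < m" and r: "r = m powr (1 - k) / c"
  shows "resolv k c m \<le> m * r powr (1 / k)"
proof -
  let ?u = "resolv k c m"
  have u: "0 \<le> ?u" "?u \<le> m" using resolv_bounds[OF k c] m by auto
  have r0: "0 < r" using r c m by simp
  have "(?u / m) powr k * m = r * (m - ?u)"
    using spow_eq_resolv[OF k c, of m] u resolv_powr_eq[OF k c m r, of m]
    by (simp add: spow_nonneg_eq mult.assoc)
  also have "\<dots> \<le> r * m" using u r0 by simp
  finally have "(?u / m) powr k \<le> r" using m by simp
  then have "((?u / m) powr k) powr (1 / k) \<le> r powr (1 / k)"
    using k by (intro powr_mono2) auto
  then have "?u / m \<le> r powr (1 / k)"
    using k u m by (simp add: powr_powr)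
  then show ?thesis using m by (simp add: field_simps)
qed

text \<open>For \<open>r\<close> up to this value, \<open>2 * r \<le> (1 / 2) powr k\<close>, which
  keeps the second iterate at or below half the datum.\<close>

definition small_threshold :: "real \<Rightarrow> real" where
  "small_threshold k = (1 / 2) powr (k + 1)"

text \<open>A product of lower bounds: \<open>1 / 2\<close> for the relative second residual,
  \<open>(3 / 2) powr (1 / k) - 1\<close> for the relative growth of the iterate, and
  \<open>(1 / 2) powr (1 / k)\<close> from \<open>t \<ge> (r / 2) powr (1 / k)\<close>.\<close>

definition quasi_opt_const :: "real \<Rightarrow> real" where
  "quasi_opt_const k = 1 / 2 * (((3 / 2) powr (1 / k) - 1) * (1 / 2) powr (1 / k))"

lemma quasi_opt_const_pos: "0 < k \<Longrightarrow> 0 < quasi_opt_const k"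
  by (simp add: quasi_opt_const_def)

text \<open>For small \<open>r\<close> both residuals stay above \<open>m / 2\<close>, so that the data of the second step exceed
  those of the first by a definite factor in \<open>c * u powr k\<close>; the iterates then differ by a fixed
  proportion of \<open>u\<close>, which itself is of order \<open>m * r powr (1 / k)\<close>.\<close>

lemma quasi_opt_ge:
  assumes k: "0 < k" and c: "0 < c" and m: "0 < m" and r: "r = m powr (1 - k) / c"
    and small: "r \<le> small_threshold k"
  shows "quasi_opt_const k * (m\<^sup>2 * r powr (1 / k)) \<le> quasi_opt k c m"
proof -
  let ?u = "resolv k c m" and ?u2 = "breg_resolv k c m"
  define t where "t = ?u / m"
  define t2 where "t2 = ?u2 / m"
  have u: "0 \<le> ?u" "?u \<le> m" "?u \<le> ?u2" "?u2 \<le> m"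
    using resolv_bounds[OF k c] breg_resolv_bounds[OF k c] m by auto
  have ut: "?u = m * t" "?u2 = m * t2" using m by (auto simp: t_def t2_def)
  have t: "0 \<le> t" "t \<le> 1" "t \<le> t2" "t2 \<le> 1"
    using u m by (auto simp: t_def t2_def divide_right_mono)
  have r0: "0 < r" using r c m by simp
  have "t powr k * m = r * (m - ?u)"
    using spow_eq_resolv[OF k c, of m] u resolv_powr_eq[OF k c m r, of m]
    by (simp add: spow_nonneg_eq mult.assoc t_def)
  then have "t powr k * m = r * (1 - t) * m"
    unfolding ut by (simp add: algebra_simps)
  then have t_eq: "t powr k = r * (1 - t)"
    using m by simp
  have "t2 powr k * m = r * (m + (m - ?u) - ?u2)"
    using spow_eq_resolv[OF k c, of "m + (m - ?u)", folded breg_resolv_def] u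
      resolv_powr_eq[OF k c m r, of "m + (m - ?u)", folded breg_resolv_def]
    by (simp add: spow_nonneg_eq mult.assoc t2_def)
  then have "t2 powr k * m = r * ((1 - t) + (1 - t2)) * m"
    unfolding ut by (simp add: algebra_simps)
  then have t2_eq: "t2 powr k = r * ((1 - t) + (1 - t2))"
    using m by simp
  have "t2 powr k \<le> r * 2" unfolding t2_eq using r0 t by (intro mult_left_mono) auto
  also have "\<dots> \<le> (1 / 2) powr k" using small by (simp add: small_threshold_def powr_add)
  finally have "t2 powr k \<le> (1 / 2) powr k" .
  from powr_mono2[OF _ _ this, of "1 / k"] have t2_half: "t2 \<le> 1 / 2"
    using k t by (simp add: powr_powr)
  have "(r / 2) powr (1 / k) \<le> (t powr k) powr (1 / k)"
    unfolding t_eq using r0 k t t2_half by (intro powr_mono2) auto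
  then have t_ge: "(r / 2) powr (1 / k) \<le> t"
    using k t by (simp add: powr_powr)
  \<comment> \<open>Since \<open>1 - t2 \<ge> 1 / 2 \<ge> (1 - t) / 2\<close>, adding the residual
    raises the right side of the equation by a factor of at least \<open>3 / 2\<close>.\<close>
  have "3 / 2 * t powr k \<le> t2 powr k"
  proof -
    have "3 / 2 * (1 - t) \<le> (1 - t) + (1 - t2)" using t t2_half by simp
    from mult_left_mono[OF this, of r] show ?thesis
      unfolding t_eq t2_eq using r0 by (simp add: mult.left_commute)
  qed
  then have "(3 / 2 * t powr k) powr (1 / k) \<le> (t2 powr k) powr (1 / k)"
    using k by (intro powr_mono2) auto
  moreover have "(3 / 2 * t powr k) powr (1 / k) = (3 / 2) powr (1 / k) * t"
    by (subst powr_mult) (use k t in \<open>auto simp: powr_powr\<close>)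
  ultimately have "(3 / 2) powr (1 / k) * t \<le> t2"
    using k t by (simp add: powr_powr)
  then have "((3 / 2) powr (1 / k) - 1) * t \<le> t2 - t" by (simp add: algebra_simps)
  moreover have "((3 / 2) powr (1 / k) - 1) * (r / 2) powr (1 / k) \<le> ((3 / 2) powr (1 / k) - 1) * t"
    using t_ge k by (intro mult_left_mono) (auto simp: ge_one_powr_ge_zero)
  ultimately have diff: "((3 / 2) powr (1 / k) - 1) * (r / 2) powr (1 / k) \<le> t2 - t" by linarith
  have "1 / 2 * (((3 / 2) powr (1 / k) - 1) * (r / 2) powr (1 / k)) \<le> (1 - t2) * (t2 - t)"
    using diff t2_half t k by (intro mult_mono) (auto simp: ge_one_powr_ge_zero)
  moreover have "(r / 2) powr (1 / k) = (1 / 2) powr (1 / k) * r powr (1 / k)"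
    using r0 by (simp add: powr_divide)
  ultimately have "quasi_opt_const k * r powr (1 / k) \<le> (1 - t2) * (t2 - t)"
    by (simp add: quasi_opt_const_def mult.assoc)
  from mult_left_mono[OF this, of "m\<^sup>2"] show ?thesis
    unfolding quasi_opt_def ut by (simp add: power2_eq_square algebra_simps)
qed

text \<open>By monotonicity and oddness both resolvents are at most
  \<open>m * r powr (1 / k)\<close> in absolute value, while the residuals differ by at most
  \<open>\<bar>v - v'\<bar> \<le> 2 * m\<close>.\<close>

lemma resolv_product_small:
  assumes k: "0 < k" and c: "0 < c" and m: "0 < m" "\<bar>v\<bar> \<le> m" "\<bar>v'\<bar> \<le> m"
    and r: "r = m powr (1 - k) / c"
  shows "(resolv k c v - resolv k c v') * ((v - resolv k c v) - (v' - resolv k c v'))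
          \<le> 4 * (m\<^sup>2 * r powr (1 / k))"
proof -
  have "\<bar>resolv k c w\<bar> \<le> m * r powr (1 / k)" if "\<bar>w\<bar> \<le> m" for w
    using resolv_le_powr[OF k c m(1) r] resolv_mono[OF k c that] abs_resolv[OF k c, of w] by simp
  from this[OF m(2)] this[OF m(3)]
  have "\<bar>resolv k c v - resolv k c v'\<bar> \<le> 2 * (m * r powr (1 / k))" by linarith
  moreover have "\<bar>(v - resolv k c v) - (v' - resolv k c v')\<bar> \<le> 2 * m"
    using resolvent_lipschitz(2)[OF k c, of v v'] m by linarith
  ultimately have "\<bar>resolv k c v - resolv k c v'\<bar> * \<bar>(v - resolv k c v) - (v' - resolv k c v')\<bar>
      \<le> 2 * (m * r powr (1 / k)) * (2 * m)"
    using m by (intro mult_mono) auto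
  then have "\<bar>(resolv k c v - resolv k c v') * ((v - resolv k c v) - (v' - resolv k c v'))\<bar>
      \<le> 4 * (m\<^sup>2 * r powr (1 / k))"
    by (simp add: power2_eq_square abs_mult mult_ac)
  then show ?thesis by (rule order_trans[OF abs_ge_self])
qed

text \<open>The maximum bounds \<open>t powr (k - 1)\<close> in both cases: by \<open>1\<close> when
  the exponent is nonnegative, and through a lower bound for \<open>t\<close> when it is
  negative.\<close>

definition large_const :: "real \<Rightarrow> real \<Rightarrow> real" where
  "large_const k C = (k + 2) * max 1 (min (1 / 2) ((C / 2) powr (1 / k)) powr (k - 1))"

lemma large_const_nonneg: "0 < k \<Longrightarrow> 0 \<le> large_const k C"
  by (simp add: large_const_def)

text \<open>When \<open>r\<close> is at least \<open>C\<close>, the ratio \<open>t = u / m\<close>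
  stays away from \<open>0\<close>: either \<open>t \<ge> 1 / 2\<close>, or
  \<open>t powr k = r * (1 - t) \<ge> C / 2\<close>.\<close>

lemma resolv_powr_large:
  assumes k: "0 < k" and c: "0 < c" and m: "0 < m" and r: "r = m powr (1 - k) / c"
    and C: "0 < C" "C \<le> r"
  shows "(k + 2) * (resolv k c m) powr (k - 1) \<le> large_const k C * m powr (k - 1)"
    and "0 < resolv k c m"
proof -
  let ?u = "resolv k c m" and ?b = "min (1 / 2) ((C / 2) powr (1 / k))"
  define t where "t = ?u / m"
  have u: "0 \<le> ?u" "?u \<le> m" using resolv_bounds[OF k c] m by auto
  have ut: "?u = m * t" using m by (auto simp: t_def)
  have t: "0 \<le> t" "t \<le> 1" using u m by (auto simp: t_def)
  have "t powr k * m = r * (m - ?u)"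
    using spow_eq_resolv[OF k c, of m] u resolv_powr_eq[OF k c m r, of m]
    by (simp add: spow_nonneg_eq mult.assoc t_def)
  then have "t powr k * m = r * (1 - t) * m"
    unfolding ut by (simp add: algebra_simps)
  then have t_eq: "t powr k = r * (1 - t)"
    using m by simp
  have b: "?b \<le> t"
  proof (cases "1 / 2 \<le> t")
    case False
    then have "C * (1 / 2) \<le> r * (1 - t)"
      using C by (intro mult_mono) auto
    then have "C / 2 \<le> t powr k" by (simp add: t_eq)
    from powr_mono2[OF _ _ this, of "1 / k"] show ?thesis
      using k t C by (simp add: powr_powr)
  qed auto
  have b0: "0 < ?b" using C by simp
  then have "0 < t" using b by linarith
  then show "0 < ?u" using m by (simp add: ut)
  have "t powr (k - 1) \<le> max 1 (?b powr (k - 1))"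
  proof (cases "1 \<le> k")
    case True
    then show ?thesis using t powr_mono2[of "k - 1" t 1] by simp
  next
    case False
    then have "t powr (k - 1) \<le> ?b powr (k - 1)"
      using b b0 by (intro powr_mono2') auto
    then show ?thesis by simp
  qed
  then have "t powr (k - 1) * m powr (k - 1) \<le> max 1 (?b powr (k - 1)) * m powr (k - 1)"
    by (intro mult_right_mono) auto
  then have "?u powr (k - 1) \<le> max 1 (?b powr (k - 1)) * m powr (k - 1)"
    unfolding ut using m t by (simp add: powr_mult mult.commute)
  then show "(k + 2) * ?u powr (k - 1) \<le> large_const k C * m powr (k - 1)"
    unfolding large_const_def using k by (simp add: mult.assoc)
qed

text \<open>The residual difference is \<open>c\<close> times a difference of signed powers, which
  the mean value estimate bounds by a multiple of the difference of the resolvents. Note that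
  \<open>m powr (k - 1) * c = 1 / r\<close>.\<close>

lemma resolv_product_large:
  assumes k: "0 < k" and c: "0 < c" and m: "m = max \<bar>v\<bar> \<bar>v'\<bar>" "0 < m"
    and r: "r = m powr (1 - k) / c" and C: "0 < C" "C \<le> r"
  shows "(resolv k c v - resolv k c v') * ((v - resolv k c v) - (v' - resolv k c v'))
          \<le> large_const k C * ((v - v')\<^sup>2 * m powr (k - 1) * c)"
proof -
  \<comment> \<open>The case in which the first datum is positive and the larger in modulus;
    swapping the data and changing both signs gives the others.\<close>
  have *: "(resolv k c v - resolv k c v') * ((v - resolv k c v) - (v' - resolv k c v'))
          \<le> large_const k C * ((v - v')\<^sup>2 * m powr (k - 1) * c)"
    if vm: "v = m" and v': "\<bar>v'\<bar> \<le> m" for v v'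
  proof -
    let ?u = "resolv k c v" and ?u' = "resolv k c v'"
    have u0: "0 < ?u" using resolv_powr_large(2)[OF k c m(2) r C] vm by simp
    have le: "\<bar>?u'\<bar> \<le> ?u"
      unfolding abs_resolv[OF k c] using resolv_mono[OF k c v'] vm by simp
    have "(v - ?u) - (v' - ?u') = c * (spow k ?u - spow k ?u')"
      using spow_eq_resolv[OF k c] by (simp add: algebra_simps)
    also have "\<dots> \<le> c * ((k + 2) * ?u powr (k - 1) * (?u - ?u'))"
      using spow_diff_le[OF k u0 le] c by simp
    also have "\<dots> \<le> c * (large_const k C * m powr (k - 1) * (?u - ?u'))"
      using resolv_powr_large(1)[OF k c m(2) r C] vm le c
      by (intro mult_left_mono mult_right_mono) auto
    finally have "(?u - ?u') * ((v - ?u) - (v' - ?u'))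
        \<le> (?u - ?u') * (c * (large_const k C * m powr (k - 1) * (?u - ?u')))"
      using le by (intro mult_left_mono) auto
    also have "\<dots> = large_const k C * ((?u - ?u')\<^sup>2 * m powr (k - 1) * c)"
      by (simp add: power2_eq_square)
    also have "\<dots> \<le> large_const k C * ((v - v')\<^sup>2 * m powr (k - 1) * c)"
      using resolvent_lipschitz(1)[OF k c, of v v'] c large_const_nonneg[OF k]
      by (intro mult_left_mono mult_right_mono) (auto simp: abs_le_square_iff)
    finally show ?thesis .
  qed
  have cases: ?thesis if "- v = m \<or> - v' = m \<or> v = m \<or> v' = m"
  proof -
    let ?u = "resolv k c v" and ?u' = "resolv k c v'"
    have sym: "(?u' - ?u) * ((v' - ?u') - (v - ?u)) = (?u - ?u') * ((v - ?u) - (v' - ?u'))"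
      "(v' - v)\<^sup>2 = (v - v')\<^sup>2"
      by (simp_all add: algebra_simps power2_eq_square)
    have neg: "(- ?u - - ?u') * ((- v - - ?u) - (- v' - - ?u')) = (?u - ?u') * ((v - ?u) - (v' - ?u'))"
      "(- v - - v')\<^sup>2 = (v - v')\<^sup>2"
      by (simp_all add: algebra_simps power2_eq_square)
    have neg': "(- ?u' - - ?u) * ((- v' - - ?u') - (- v - - ?u)) = (?u - ?u') * ((v - ?u) - (v' - ?u'))"
      "(- v' - - v)\<^sup>2 = (v - v')\<^sup>2"
      by (simp_all add: algebra_simps power2_eq_square)
    have "\<bar>v\<bar> \<le> m" "\<bar>v'\<bar> \<le> m" using m(1) by auto
    then show ?thesis
      using that *[of v v'] *[of v' v, unfolded sym]
        *[of "- v" "- v'", unfolded resolv_minus[OF k c] neg]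
        *[of "- v'" "- v", unfolded resolv_minus[OF k c] neg']
      by auto
  qed
  show ?thesis by (rule cases) (use m(1) in \<open>auto simp: max_def abs_if split: if_splits\<close>)
qed

section \<open>Positivity of the criterion and a uniform lower bound on compact parameter
  sets\<close>

lemma quasi_opt_pos:
  assumes "0 < k" "0 < c" "0 < v"
  shows "0 < quasi_opt k c v"
proof -
  let ?u = "resolv k c v" and ?u2 = "breg_resolv k c v"
  note b = resolv_bounds[OF assms(1,2), of v] breg_resolv_bounds[OF assms(1,2), of v]
  note e = resolv_eq[OF assms(1,2), of v]
    resolv_eq[OF assms(1,2), of "v + (v - ?u)", folded breg_resolv_def]
  \<comment> \<open>Equal iterates would force the first residual to vanish, hence
    \<open>v = ?u = 0\<close>.\<close>
  have "?u \<noteq> ?u2"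
  proof
    assume eq: "?u = ?u2"
    then have "v = ?u" using e by simp
    then have "c * spow k ?u = 0" using e by simp
    then have "?u = 0" using assms(2) by (simp add: spow_def sgn_eq_0_iff)
    then show False using \<open>v = ?u\<close> assms(3) by simp
  qed
  moreover have "?u2 \<noteq> v"
  proof
    assume eq: "?u2 = v"
    then have "c * spow k v = c * spow k ?u" using e by simp
    then have "v = ?u"
      using spow_strict_mono[OF assms(1), of ?u v] assms b by (cases "v = ?u") auto
    then show False using \<open>?u \<noteq> ?u2\<close> eq by simp
  qed
  ultimately show ?thesis
    using b assms(3) unfolding quasi_opt_def by (intro mult_pos_pos) auto
qed

text \<open>The pairs of iterates with parameters in a compact box form a compact set.\<close>

lemma quasi_opt_lower_bound:
  assumes k: "0 < k" and c: "0 < c0" and v: "0 < v0"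
  shows "\<exists>e>0. \<forall>c\<in>{c0..c1}. \<forall>v. \<bar>v\<bar> \<in> {v0..v1} \<longrightarrow> e \<le> quasi_opt k c v"
proof -
  \<comment> \<open>The set is cut out by the two equations rather than described through
    \<open>resolv\<close>, so that its compactness follows from continuity of \<open>f\<close> and
    does not require continuity of \<open>resolv\<close> in its parameters.\<close>
  define S where "S = {(c, v, u, u2). c \<in> {c0..c1} \<and> v \<in> {v0..v1} \<and> u \<in> {0..v1} \<and> u2 \<in> {0..v1}
     \<and> u + c * u powr k = v \<and> u2 + c * u2 powr k = v + (v - u)}"
  define B where "B = {c0..c1} \<times> {v0..v1} \<times> {0..v1} \<times> {0..v1}"
  define f where "f = (\<lambda>(c::real, v, u, u2). (u + c * u powr k - v, u2 + c * u2 powr k - (v + (v - u))))"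
  define g where "g = (\<lambda>(c::real, v::real, u, u2). (v - u2) * (u2 - u))"
  have "compact B" unfolding B_def by (intro compact_Times compact_Icc)
  have "continuous_on B f"
    unfolding f_def B_def case_prod_unfold
    using k by (intro continuous_intros continuous_on_powr') auto
  have closed: "closedin (top_of_set B) (B \<inter> f -` {(0, 0)})"
    using \<open>continuous_on B f\<close> by (intro continuous_closedin_preimage) auto
  have "compact (B \<inter> f -` {(0, 0)})"
    using closedin_compact[OF \<open>compact B\<close> closed] .
  moreover have "S = B \<inter> f -` {(0, 0)}"
    by (auto simp: S_def B_def f_def)
  ultimately have S: "compact S" by simp
  have in_S: "(c, v, resolv k c v, breg_resolv k c v) \<in> S" if "c \<in> {c0..c1}" "v \<in> {v0..v1}" for c v
  proof -
    have cv: "0 < c" "0 \<le> v" using that assms by auto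
    note b = resolv_bounds[OF k cv] breg_resolv_bounds[OF k cv]
    note e = resolv_eq[OF k cv(1), of v]
      resolv_eq[OF k cv(1), of "v + (v - resolv k c v)", folded breg_resolv_def]
    show ?thesis using that b e by (auto simp: S_def spow_nonneg_eq)
  qed
  have g: "g (c, v, resolv k c v, breg_resolv k c v) = quasi_opt k c v" for c v
    by (simp add: g_def quasi_opt_def)
  have S_pos: "0 < g x" if "x \<in> S" for x
  proof -
    obtain c v u u2 where x: "x = (c, v, u, u2)" by (cases x)
    have *: "0 < c" "0 < v" "u + c * spow k u = v" "u2 + c * spow k u2 = v + (v - u)"
      using that assms by (auto simp: x S_def spow_nonneg_eq)
    then have "u = resolv k c v" using resolv_unique[OF k] by metis
    moreover from this have "u2 = breg_resolv k c v"
      using resolv_unique[OF k *(1) *(4)] by (simp add: breg_resolv_def)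
    ultimately show ?thesis using quasi_opt_pos[OF k *(1,2)] by (simp add: x g)
  qed
  have pos_box: "\<exists>e>0. \<forall>c\<in>{c0..c1}. \<forall>v\<in>{v0..v1}. e \<le> quasi_opt k c v"
  proof (cases "S = {}")
    \<comment> \<open>An empty solution set means an empty parameter box, where any positive
      constant will do.\<close>
    case True
    then have "c \<notin> {c0..c1} \<or> v \<notin> {v0..v1}" for c v using in_S by blast
    then show ?thesis by (intro exI[of _ 1]) (meson zero_less_one)
  next
    case False
    have "continuous_on S g"
      unfolding g_def case_prod_unfold by (intro continuous_intros)
    from continuous_attains_inf[OF S False this] obtain x where x: "x \<in> S" "\<forall>z\<in>S. g x \<le> g z" by blast
    show ?thesis using x in_S S_pos[OF x(1)] g by (intro exI[of _ "g x"]) metis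
  qed
  then obtain e where e: "e > 0" "\<forall>c\<in>{c0..c1}. \<forall>v\<in>{v0..v1}. e \<le> quasi_opt k c v" by blast
  show ?thesis
  proof (intro exI[of _ e] conjI ballI allI impI)
    fix c v assume cv: "c \<in> {c0..c1}" "\<bar>v\<bar> \<in> {v0..v1}"
    then have "0 < c" using c by auto
    then show "e \<le> quasi_opt k c v" using e(2) cv quasi_opt_abs[OF k, of c v] by metis
  qed (use e in auto)
qed

section \<open>Tikhonov regularisation and Bregman iteration for a diagonal operator\<close>

lemma abs_powr_2 [simp]: "\<bar>x::real\<bar> powr 2 = x\<^sup>2"
  by (cases "x = 0") (auto simp: powr_numeral)

lemma lp_2_iff: "x \<in> lp 2 \<longleftrightarrow> summable (\<lambda>n. (x n)\<^sup>2)"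
  by (simp add: lp_def)

lemma lp_norm_nonneg: "0 \<le> lp_norm p x"
  by (simp add: lp_norm_def)

lemma lp_norm_powr:
  assumes "p \<noteq> 0" "x \<in> lp p"
  shows "lp_norm p x powr p = (\<Sum>n. \<bar>x n\<bar> powr p)"
  using assms by (simp add: lp_norm_def lp_def powr_powr suminf_nonneg)

lemma lp_norm_2_sq:
  assumes "x \<in> lp 2"
  shows "(lp_norm 2 x)\<^sup>2 = (\<Sum>n. (x n)\<^sup>2)"
proof -
  have "(lp_norm 2 x)\<^sup>2 = \<bar>lp_norm 2 x\<bar> powr 2" by (rule abs_powr_2[symmetric])
  also have "\<dots> = (\<Sum>n. (x n)\<^sup>2)"
    using lp_norm_powr[of 2 x] assms by (simp add: lp_norm_nonneg)
  finally show ?thesis .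
qed

lemma lp_comparison:
  assumes "p \<ge> 0" "z \<in> lp p" "\<And>n. \<bar>x n\<bar> \<le> \<bar>z n\<bar>"
  shows "x \<in> lp p"
proof -
  have "summable (\<lambda>n. \<bar>z n\<bar> powr p)" using assms(2) by (simp add: lp_def)
  then have "summable (\<lambda>n. \<bar>x n\<bar> powr p)"
    by (rule summable_comparison_test') (use assms in \<open>auto intro: powr_mono2\<close>)
  then show ?thesis by (simp add: lp_def)
qed

lemma lp_diff:
  assumes "p \<ge> 0" "x \<in> lp p" "z \<in> lp p"
  shows "(\<lambda>n. x n - z n) \<in> lp p"
proof -
  have "summable (\<lambda>n. 2 powr p * (\<bar>x n\<bar> powr p + \<bar>z n\<bar> powr p))"
    using assms by (intro summable_mult summable_add) (auto simp: lp_def)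
  then have "summable (\<lambda>n. \<bar>x n - z n\<bar> powr p)"
  proof (rule summable_comparison_test')
    fix n
    have "\<bar>x n - z n\<bar> powr p \<le> (2 * max \<bar>x n\<bar> \<bar>z n\<bar>) powr p"
      using assms(1) by (intro powr_mono2) auto
    also have "\<dots> = 2 powr p * max \<bar>x n\<bar> \<bar>z n\<bar> powr p" by (simp add: powr_mult)
    also have "\<dots> \<le> 2 powr p * (\<bar>x n\<bar> powr p + \<bar>z n\<bar> powr p)"
      by (intro mult_left_mono) (auto simp: max_def)
    finally show "norm (\<bar>x n - z n\<bar> powr p) \<le> 2 powr p * (\<bar>x n\<bar> powr p + \<bar>z n\<bar> powr p)" by simp
  qed
  then show ?thesis by (simp add: lp_def)
qed

lemma lp_uminus: "x \<in> lp p \<Longrightarrow> (\<lambda>n. - x n) \<in> lp p"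
  by (simp add: lp_def)

lemma lp_add:
  assumes "p \<ge> 0" "x \<in> lp p" "z \<in> lp p"
  shows "(\<lambda>n. x n + z n) \<in> lp p"
  using lp_diff[OF assms(1,2) lp_uminus[OF assms(3)]] by simp

lemma lp_2_summable_mult:
  assumes "x \<in> lp 2" "z \<in> lp 2"
  shows "summable (\<lambda>n. x n * z n)"
proof -
  have "summable (\<lambda>n. (x n)\<^sup>2 + (z n)\<^sup>2)"
    using assms by (intro summable_add) (auto simp: lp_2_iff)
  then show ?thesis
  proof (rule summable_comparison_test')
    fix n
    have "0 \<le> \<bar>x n\<bar> * \<bar>z n\<bar>" by simp
    then show "norm (x n * z n) \<le> (x n)\<^sup>2 + (z n)\<^sup>2"
      using sum_squares_bound[of "\<bar>x n\<bar>" "\<bar>z n\<bar>"]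
      unfolding real_norm_def abs_mult power2_abs by linarith
  qed
qed

lemma lp_2_coord_le:
  assumes "x \<in> lp 2"
  shows "\<bar>x n\<bar> \<le> lp_norm 2 x"
proof -
  have "(\<Sum>k\<in>{n}. (x k)\<^sup>2) \<le> (\<Sum>k. (x k)\<^sup>2)"
    using assms by (intro sum_le_suminf) (auto simp: lp_2_iff)
  then have "\<bar>x n\<bar>\<^sup>2 \<le> (lp_norm 2 x)\<^sup>2" by (simp add: lp_norm_2_sq[OF assms])
  then show ?thesis by (rule power2_le_imp_le) (rule lp_norm_nonneg)
qed

lemma lp_finite_support:
  assumes "finite N" "\<And>n. n \<notin> N \<Longrightarrow> x n = 0"
  shows "x \<in> lp p"
  unfolding lp_def using assms by (auto intro!: summable_finite[of N])

section \<open>The operator as multiplication by \<open>lam\<close>\<close>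

locale diagonal_operator =
  fixes q :: real and lam :: "nat \<Rightarrow> real" and A :: "rseq \<Rightarrow> rseq"
  assumes q: "1 < q"
    and lam_pos: "\<And>n. 0 < lam n"
    and A_bounded: "bounded_operator q A"
    and A_basis: "\<And>n. A (std_basis n) = (\<lambda>k. lam n * std_basis n k)"
begin

lemma A_linear:
  "x \<in> lp q \<Longrightarrow> z \<in> lp q \<Longrightarrow> A (\<lambda>n. a * x n + b * z n) = (\<lambda>n. a * A x n + b * A z n)"
  using A_bounded by (auto simp: bounded_operator_def)

lemma A_lp: "x \<in> lp q \<Longrightarrow> A x \<in> lp 2"
  using A_bounded by (auto simp: bounded_operator_def)

lemma A_truncation: "A (\<lambda>k. if k < N then x k else 0) = (\<lambda>k. if k < N then lam k * x k else 0)"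
proof (induction N)
  case 0
  show ?case using A_linear[of "\<lambda>_. 0" "\<lambda>_. 0" 0 0] by (simp add: lp_def)
next
  case (Suc N)
  let ?t = "\<lambda>k. if k < N then x k else 0"
  have t: "?t \<in> lp q" by (rule lp_finite_support[of "{..<N}"]) auto
  have e: "std_basis N \<in> lp q" by (rule lp_finite_support[of "{N}"]) (auto simp: std_basis_def)
  have "(\<lambda>k. if k < Suc N then x k else 0) = (\<lambda>k. 1 * ?t k + x N * std_basis N k)"
    by (auto simp: std_basis_def less_Suc_eq)
  then have "A (\<lambda>k. if k < Suc N then x k else 0)
      = (\<lambda>k. 1 * A ?t k + x N * A (std_basis N) k)"
    using A_linear[OF t e, of 1 "x N"] by simp
  also have "\<dots> = (\<lambda>k. if k < Suc N then lam k * x k else 0)"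
    unfolding Suc.IH A_basis by (auto simp: std_basis_def less_Suc_eq)
  finally show ?case .
qed

lemma lp_tail_tendsto_0:
  assumes "x \<in> lp q"
  shows "(\<lambda>N. lp_norm q (\<lambda>k. if k < N then 0 else x k)) \<longlonglongrightarrow> 0"
proof -
  let ?f = "\<lambda>k. \<bar>x k\<bar> powr q"
  have f: "summable ?f" using assms by (simp add: lp_def)
  have "(\<Sum>k. \<bar>if k < N then 0 else x k\<bar> powr q) = suminf ?f - (\<Sum>k<N. ?f k)" for N
  proof -
    have "(\<lambda>k. ?f k - (if k \<in> {..<N} then ?f k else 0)) sums (suminf ?f - (\<Sum>k<N. ?f k))"
      by (intro sums_diff summable_sums f sums_If_finite_set) auto
    also have "(\<lambda>k. ?f k - (if k \<in> {..<N} then ?f k else 0))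
        = (\<lambda>k. \<bar>if k < N then 0 else x k\<bar> powr q)" by auto
    finally show ?thesis by (rule sums_unique[symmetric])
  qed
  moreover have "(\<lambda>N. suminf ?f - (\<Sum>k<N. ?f k)) \<longlonglongrightarrow> suminf ?f - suminf ?f"
    by (intro tendsto_intros summable_LIMSEQ f)
  ultimately have "(\<lambda>N. \<Sum>k. \<bar>if k < N then 0 else x k\<bar> powr q) \<longlonglongrightarrow> 0" by simp
  then have "(\<lambda>N. (\<Sum>k. \<bar>if k < N then 0 else x k\<bar> powr q) powr (1 / q)) \<longlonglongrightarrow> 0"
  proof (rule tendsto_zero_powrI)
    have "(\<lambda>k. if k < N then 0 else x k) \<in> lp q" for N
      by (rule lp_comparison[OF _ assms]) (use q in auto)
    then show "\<forall>\<^sub>F N in sequentially. 0 \<le> (\<Sum>k. \<bar>if k < N then 0 else x k\<bar> powr q)"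
      by (intro always_eventually allI suminf_nonneg) (auto simp: lp_def)
  qed (use q in auto)
  then show ?thesis by (simp add: lp_norm_def)
qed

text \<open>Linearity determines \<open>A\<close> on truncations. For \<open>n < N\<close> the
  \<open>n\<close>-th coordinate of the defect is that of \<open>A\<close> applied to the tail of
  \<open>x\<close>, and boundedness makes it vanish as \<open>N\<close> grows.\<close>

lemma A_diag:
  assumes x: "x \<in> lp q"
  shows "A x = (\<lambda>n. lam n * x n)"
proof
  fix n
  obtain K where K: "\<And>x. x \<in> lp q \<Longrightarrow> lp_norm 2 (A x) \<le> K * lp_norm q x"
    using A_bounded unfolding bounded_operator_def by blast
  let ?t = "\<lambda>N k. if k < N then x k else 0" and ?r = "\<lambda>N k. if k < N then 0 else x k"
  have "\<bar>A x n - lam n * x n\<bar> \<le> K * lp_norm q (?r N)" if N: "n < N" for N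
  proof -
    have t: "?t N \<in> lp q" by (rule lp_finite_support[of "{..<N}"]) auto
    have r: "?r N \<in> lp q" by (rule lp_comparison[OF _ x]) (use q in auto)
    have "x = (\<lambda>k. 1 * ?t N k + 1 * ?r N k)" by auto
    then have "A x = (\<lambda>k. 1 * A (?t N) k + 1 * A (?r N) k)"
      using A_linear[OF t r, of 1 1] by metis
    then have "A x n - lam n * x n = A (?r N) n"
      using N by (simp add: A_truncation)
    then show ?thesis
      using lp_2_coord_le[OF A_lp[OF r], of n] K[OF r] by simp
  qed
  then have ev: "\<forall>\<^sub>F N in sequentially. \<bar>A x n - lam n * x n\<bar> \<le> K * lp_norm q (?r N)"
    by (intro eventually_sequentiallyI[of "Suc n"]) auto
  have "(\<lambda>N. K * lp_norm q (?r N)) \<longlonglongrightarrow> K * 0"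
    by (intro tendsto_mult tendsto_const lp_tail_tendsto_0 x)
  from tendsto_lowerbound[OF this ev] show "A x n = lam n * x n" by simp
qed

lemma diag_lp: "x \<in> lp q \<Longrightarrow> (\<lambda>n. lam n * x n) \<in> lp 2"
  using A_lp A_diag by metis

lemma Reg_eq: "x \<in> lp q \<Longrightarrow> Reg q x = (1 / q) * (\<Sum>n. \<bar>x n\<bar> powr q)"
  using lp_norm_powr[of q x] q by (simp add: Reg_def)

section \<open>Componentwise form of the two minimisers\<close>

abbreviation kappa :: "real \<Rightarrow> nat \<Rightarrow> real" where
  "kappa \<alpha> n \<equiv> \<alpha> / lam n powr q"

text \<open>This is the image under \<open>A\<close> of the minimiser, not the minimiser itself.
  Putting \<open>u = lam n * x n\<close> in the stationarity equation costs \<open>q - 1\<close>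
  powers of \<open>lam n\<close> by homogeneity and one more by division, whence
  \<open>lam n powr q\<close> in \<open>kappa\<close>.\<close>

definition T1 :: "real \<Rightarrow> rseq \<Rightarrow> rseq" where
  "T1 \<alpha> v n = resolv (q - 1) (kappa \<alpha> n) (v n)"

definition T2 :: "real \<Rightarrow> rseq \<Rightarrow> rseq" where
  "T2 \<alpha> v n = breg_resolv (q - 1) (kappa \<alpha> n) (v n)"

lemma kappa_pos: "0 < \<alpha> \<Longrightarrow> 0 < kappa \<alpha> n"
  using lam_pos[of n] by simp

lemma q1: "0 < q - 1"
  using q by simp

text \<open>The stationarity equation of the Tikhonov functional in the original variable.\<close>

lemma spow_T1_div:
  assumes "0 < \<alpha>"
  shows "\<alpha> * spow (q - 1) (T1 \<alpha> v n / lam n) = lam n * (v n - T1 \<alpha> v n)"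
proof -
  have l: "0 < lam n" by (rule lam_pos)
  have "\<alpha> * spow (q - 1) (T1 \<alpha> v n / lam n) = lam n * (kappa \<alpha> n * spow (q - 1) (T1 \<alpha> v n))"
    using l by (simp add: spow_divide powr_diff)
  also have "\<dots> = lam n * (v n - T1 \<alpha> v n)"
    unfolding T1_def spow_eq_resolv[OF q1 kappa_pos[OF assms]] ..
  finally show ?thesis .
qed

lemma T1_bounds:
  assumes "0 < \<alpha>"
  shows "\<bar>T1 \<alpha> v n\<bar> \<le> \<bar>v n\<bar>" "\<bar>v n - T1 \<alpha> v n\<bar> \<le> \<bar>v n\<bar>"
  using resolvent_lipschitz[OF q1 kappa_pos[OF assms, of n], of "v n" 0]
    resolv_0[OF q1 kappa_pos[OF assms, of n]]
  by (simp_all add: T1_def)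

lemma T1_lp_2:
  assumes "0 < \<alpha>" "v \<in> lp 2"
  shows "T1 \<alpha> v \<in> lp 2" "(\<lambda>n. v n - T1 \<alpha> v n) \<in> lp 2"
  using T1_bounds[OF assms(1), of v] by (auto intro!: lp_comparison[OF _ assms(2)])

text \<open>Multiplying the stationarity equation by the solution shows that its \<open>q\<close>-th
  powers are, up to \<open>1 / \<alpha>\<close>, products of two square summable sequences.\<close>

lemma T1_div_lp:
  assumes "0 < \<alpha>" "v \<in> lp 2"
  shows "(\<lambda>n. T1 \<alpha> v n / lam n) \<in> lp q"
proof -
  have *: "\<bar>T1 \<alpha> v n / lam n\<bar> powr q = (v n - T1 \<alpha> v n) * T1 \<alpha> v n / \<alpha>" for n
  proof -
    let ?x = "T1 \<alpha> v n / lam n"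
    have "\<alpha> * \<bar>?x\<bar> powr q = \<alpha> * spow (q - 1) ?x * ?x"
      using spow_mult_self[of "q - 1" ?x] by (simp only: mult.assoc diff_add_cancel)
    also have "\<dots> = (v n - T1 \<alpha> v n) * T1 \<alpha> v n"
      unfolding spow_T1_div[OF assms(1)] using lam_pos[of n] by simp
    finally show ?thesis using assms(1) by (simp add: field_simps)
  qed
  show ?thesis unfolding lp_def mem_Collect_eq *
    using T1_lp_2[OF assms] by (intro summable_divide lp_2_summable_mult) auto
qed

definition tik_objective :: "rseq \<Rightarrow> real \<Rightarrow> rseq \<Rightarrow> real" where
  "tik_objective v \<alpha> x = 1 / 2 * (lp_norm 2 (\<lambda>n. A x n - v n))\<^sup>2 + \<alpha> * Reg q x"

lemma tik_objective_sums:
  assumes "x \<in> lp q" "v \<in> lp 2"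
  shows "(\<lambda>n. 1 / 2 * (lam n * x n - v n)\<^sup>2 + \<alpha> * (1 / q * \<bar>x n\<bar> powr q)) sums tik_objective v \<alpha> x"
proof -
  have d: "(\<lambda>n. lam n * x n - v n) \<in> lp 2"
    using diag_lp[OF assms(1)] assms(2) by (intro lp_diff) auto
  have x: "summable (\<lambda>n. \<bar>x n\<bar> powr q)" using assms(1) by (simp add: lp_def)
  show ?thesis
    unfolding tik_objective_def A_diag[OF assms(1)] lp_norm_2_sq[OF d] Reg_eq[OF assms(1)]
    using d x by (intro sums_add sums_mult summable_sums) (auto simp: lp_2_iff)
qed

text \<open>Strong convexity in \<open>A x\<close> gives existence and uniqueness of the minimiser at once.\<close>

lemma tik_objective_ge:
  assumes "0 < \<alpha>" "v \<in> lp 2" "z \<in> lp q"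
  shows "tik_objective v \<alpha> (\<lambda>n. T1 \<alpha> v n / lam n)
      + (\<Sum>n. 1 / 2 * (lam n * z n - T1 \<alpha> v n)\<^sup>2) \<le> tik_objective v \<alpha> z"
proof -
  let ?x = "\<lambda>n. T1 \<alpha> v n / lam n"
  have "(\<lambda>n. lam n * z n - T1 \<alpha> v n) \<in> lp 2"
    using diag_lp[OF assms(3)] T1_lp_2[OF assms(1,2)] by (intro lp_diff) auto
  then have s: "(\<lambda>n. 1 / 2 * (lam n * z n - T1 \<alpha> v n)\<^sup>2) sums (\<Sum>n. 1 / 2 * (lam n * z n - T1 \<alpha> v n)\<^sup>2)"
    by (intro summable_sums summable_mult) (simp add: lp_2_iff)
  show ?thesis
  proof (rule sums_le[OF _ sums_add[OF tik_objective_sums[OF T1_div_lp[OF assms(1,2)] assms(2)] s]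
          tik_objective_sums[OF assms(3,2)]])
    fix n
    let ?u = "T1 \<alpha> v n" and ?l = "lam n"
    have l: "0 < ?l" by (rule lam_pos)
    have "\<alpha> * (1 / q * \<bar>?x n\<bar> powr q) + \<alpha> * spow (q - 1) (?x n) * (z n - ?x n)
        \<le> \<alpha> * (1 / q * \<bar>z n\<bar> powr q)"
      using mult_left_mono[OF powr_subgradient[OF q, of "?x n" "z n"], of \<alpha>] assms(1)
      by (simp add: distrib_left)
    also have "\<alpha> * spow (q - 1) (?x n) * (z n - ?x n) = (v n - ?u) * (?l * z n - ?u)"
      unfolding spow_T1_div[OF assms(1)] using l by (simp add: field_simps)
    finally have "\<alpha> * (1 / q * \<bar>?x n\<bar> powr q) + (v n - ?u) * (?l * z n - ?u)
        \<le> \<alpha> * (1 / q * \<bar>z n\<bar> powr q)" .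
    \<comment> \<open>Expanding around \<open>?u\<close> leaves exactly the cross term supplied by
      the subgradient inequality, together with the extra square.\<close>
    moreover have "1 / 2 * (?u - v n)\<^sup>2 + 1 / 2 * (?l * z n - ?u)\<^sup>2
        = 1 / 2 * (?l * z n - v n)\<^sup>2 + (v n - ?u) * (?l * z n - ?u)"
      by (simp add: power2_eq_square field_simps)
    moreover have "?l * ?x n = ?u" using l by simp
    ultimately show "1 / 2 * (?l * ?x n - v n)\<^sup>2 + \<alpha> * (1 / q * \<bar>?x n\<bar> powr q)
        + 1 / 2 * (?l * z n - ?u)\<^sup>2 \<le> 1 / 2 * (?l * z n - v n)\<^sup>2 + \<alpha> * (1 / q * \<bar>z n\<bar> powr q)"
      by (simp only:)
  qed
qed

text \<open>Allowing an additive constant lets the same statement identify both the Tikhonov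
  solution and the Bregman iterate.\<close>

lemma the_arg_min_tik:
  assumes "0 < \<alpha>" "v \<in> lp 2" and G: "\<And>x. x \<in> lp q \<Longrightarrow> G x = tik_objective v \<alpha> x + C"
  shows "(THE x. is_arg_min G (\<lambda>x. x \<in> lp q) x) = (\<lambda>n. T1 \<alpha> v n / lam n)"
proof (rule the_equality)
  let ?X = "\<lambda>n. T1 \<alpha> v n / lam n"
  note X = T1_div_lp[OF assms(1,2)]
  have sum: "summable (\<lambda>n. 1 / 2 * (lam n * z n - T1 \<alpha> v n)\<^sup>2)" if "z \<in> lp q" for z
    using lp_diff[OF _ diag_lp[OF that] T1_lp_2(1)[OF assms(1,2)]]
    by (intro summable_mult) (simp add: lp_2_iff)
  show "is_arg_min G (\<lambda>x. x \<in> lp q) ?X"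
    unfolding is_arg_min_def
  proof (intro conjI X notI)
    assume "\<exists>z. z \<in> lp q \<and> G z < G ?X"
    then obtain z where z: "z \<in> lp q" "G z < G ?X" by blast
    have "0 \<le> (\<Sum>n. 1 / 2 * (lam n * z n - T1 \<alpha> v n)\<^sup>2)"
      by (intro suminf_nonneg sum z) auto
    then show False using tik_objective_ge[OF assms(1,2) z(1)] z(2) G[OF X] G[OF z(1)] by simp
  qed
  fix z assume "is_arg_min G (\<lambda>x. x \<in> lp q) z"
  then have z: "z \<in> lp q" "G z \<le> G ?X"
    using X unfolding is_arg_min_def by (auto simp: not_less)
  then have "(\<Sum>n. 1 / 2 * (lam n * z n - T1 \<alpha> v n)\<^sup>2) \<le> 0"
    using tik_objective_ge[OF assms(1,2) z(1)] G[OF X] G[OF z(1)] by simp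
  moreover have "0 \<le> (\<Sum>n. 1 / 2 * (lam n * z n - T1 \<alpha> v n)\<^sup>2)"
    by (intro suminf_nonneg sum z) auto
  ultimately have "\<forall>n. 1 / 2 * (lam n * z n - T1 \<alpha> v n)\<^sup>2 = 0"
    using suminf_eq_zero_iff[OF sum[OF z(1)]] by simp
  then have "lam n * z n = T1 \<alpha> v n" for n by simp
  then show "z = ?X" using lam_pos by (auto simp: field_simps less_imp_neq[symmetric])
qed

lemma tik_sol_eq:
  assumes "0 < \<alpha>" "v \<in> lp 2"
  shows "tik_sol q A v \<alpha> = (\<lambda>n. T1 \<alpha> v n / lam n)"
  unfolding tik_sol_def
  by (rule the_arg_min_tik[OF assms, of _ 0]) (simp add: tik_objective_def)

lemma A_tik_sol:
  assumes "0 < \<alpha>" "v \<in> lp 2"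
  shows "A (tik_sol q A v \<alpha>) = T1 \<alpha> v"
  unfolding tik_sol_eq[OF assms] A_diag[OF T1_div_lp[OF assms]]
  using lam_pos by (auto simp: less_imp_neq[symmetric])

lemma T2_eq_T1: "T2 \<alpha> v = T1 \<alpha> (\<lambda>n. v n + (v n - T1 \<alpha> v n))"
  by (auto simp: T2_def T1_def breg_resolv_def)

lemma T2_div_lp:
  assumes "0 < \<alpha>" "v \<in> lp 2"
  shows "(\<lambda>n. v n + (v n - T1 \<alpha> v n)) \<in> lp 2" "(\<lambda>n. T2 \<alpha> v n / lam n) \<in> lp q" "T2 \<alpha> v \<in> lp 2"
proof -
  show *: "(\<lambda>n. v n + (v n - T1 \<alpha> v n)) \<in> lp 2"
    using T1_lp_2[OF assms] assms by (intro lp_add) auto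
  show "(\<lambda>n. T2 \<alpha> v n / lam n) \<in> lp q" "T2 \<alpha> v \<in> lp 2"
    unfolding T2_eq_T1 using T1_div_lp[OF assms(1) *] T1_lp_2(1)[OF assms(1) *] by auto
qed

text \<open>Completing the square: a Bregman step is a Tikhonov step with the residual added to the data.\<close>

lemma breg_sol_eq:
  assumes "0 < \<alpha>" "v \<in> lp 2"
  shows "breg_sol q A v \<alpha> = (\<lambda>n. T2 \<alpha> v n / lam n)"
  unfolding breg_sol_def T2_eq_T1
proof (rule the_arg_min_tik[OF assms(1) T2_div_lp(1)[OF assms]])
  fix x assume x: "x \<in> lp q"
  let ?X = "\<lambda>n. T1 \<alpha> v n / lam n" and ?p = "\<lambda>n. v n - T1 \<alpha> v n"
  note X = T1_div_lp[OF assms]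
  have xX: "(\<lambda>n. x n - ?X n) \<in> lp q" using x X q by (intro lp_diff) auto
  have AxX: "A (\<lambda>n. x n - ?X n) = (\<lambda>n. lam n * x n - T1 \<alpha> v n)"
    unfolding A_diag[OF xX] using lam_pos by (auto simp: field_simps less_imp_neq[symmetric])
  have l2: "(\<lambda>n. lam n * x n) \<in> lp 2" "T1 \<alpha> v \<in> lp 2" "?p \<in> lp 2"
    using diag_lp[OF x] T1_lp_2[OF assms] by auto
  have l2': "(\<lambda>n. lam n * x n - T1 \<alpha> v n) \<in> lp 2" "(\<lambda>n. lam n * x n - v n) \<in> lp 2"
    "(\<lambda>n. lam n * x n - (v n + ?p n)) \<in> lp 2"
    using l2 assms(2) T2_div_lp(1)[OF assms] by (auto intro!: lp_diff)
  have dual: "\<alpha> * tik_dual q A v \<alpha> (\<lambda>n. x n - ?X n) = (\<Sum>n. ?p n * (lam n * x n - T1 \<alpha> v n))"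
  proof -
    have "(\<Sum>n. (T1 \<alpha> v n - v n) * (lam n * x n - T1 \<alpha> v n))
        = (\<Sum>n. - (?p n * (lam n * x n - T1 \<alpha> v n)))"
      by (simp add: algebra_simps)
    also have "\<dots> = - (\<Sum>n. ?p n * (lam n * x n - T1 \<alpha> v n))"
      by (intro suminf_minus lp_2_summable_mult l2 l2')
    finally show ?thesis
      using assms(1) by (simp add: tik_dual_def adj_def l2_inner_def A_tik_sol[OF assms] AxX)
  qed
  have s1: "(\<lambda>n. (lam n * x n - v n)\<^sup>2) sums (\<Sum>n. (lam n * x n - v n)\<^sup>2)"
    and s2: "(\<lambda>n. (lam n * x n - (v n + ?p n))\<^sup>2) sums (\<Sum>n. (lam n * x n - (v n + ?p n))\<^sup>2)"
    and s3: "(\<lambda>n. ?p n * (lam n * x n - T1 \<alpha> v n)) sums (\<Sum>n. ?p n * (lam n * x n - T1 \<alpha> v n))"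
    and s4: "(\<lambda>n. ?p n * ?p n) sums (\<Sum>n. ?p n * ?p n)"
    using l2 l2' by (auto intro!: summable_sums lp_2_summable_mult simp: lp_2_iff)
  have "(\<lambda>n. 1 / 2 * (lam n * x n - v n)\<^sup>2 - ?p n * (lam n * x n - T1 \<alpha> v n)) sums
    (1 / 2 * (\<Sum>n. (lam n * x n - (v n + ?p n))\<^sup>2) - 3 / 2 * (\<Sum>n. ?p n * ?p n))"
  proof -
    \<comment> \<open>Completing the square costs half of \<open>?p n * ?p n\<close>; a further
      whole one comes from
      \<open>lam n * x n - T1 \<alpha> v n = (lam n * x n - v n) + ?p n\<close>.\<close>
    have "(\<lambda>n. 1 / 2 * (lam n * x n - v n)\<^sup>2 - ?p n * (lam n * x n - T1 \<alpha> v n))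
      = (\<lambda>n. 1 / 2 * (lam n * x n - (v n + ?p n))\<^sup>2 - 3 / 2 * (?p n * ?p n))"
      by (auto simp: power2_eq_square field_simps)
    then show ?thesis by (simp only:) (intro sums_diff sums_mult s2 s4)
  qed
  then have sq: "1 / 2 * (\<Sum>n. (lam n * x n - v n)\<^sup>2) - (\<Sum>n. ?p n * (lam n * x n - T1 \<alpha> v n))
      = 1 / 2 * (\<Sum>n. (lam n * x n - (v n + ?p n))\<^sup>2) - 3 / 2 * (\<Sum>n. ?p n * ?p n)"
    using sums_unique2[OF sums_diff[OF sums_mult[OF s1, of "1 / 2"] s3]] by simp
  show "1 / 2 * (lp_norm 2 (\<lambda>n. A x n - v n))\<^sup>2
        + \<alpha> * bregman (Reg q) (tik_dual q A v \<alpha>) x (tik_sol q A v \<alpha>)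
      = tik_objective (\<lambda>n. v n + ?p n) \<alpha> x + (- 3 / 2 * (\<Sum>n. ?p n * ?p n) - \<alpha> * Reg q ?X)"
    using sq dual
    unfolding tik_objective_def bregman_def A_diag[OF x] tik_sol_eq[OF assms]
      lp_norm_2_sq[OF l2'(2)] lp_norm_2_sq[OF l2'(3)]
    by (simp add: algebra_simps)
qed

lemma A_breg_sol:
  assumes "0 < \<alpha>" "v \<in> lp 2"
  shows "A (breg_sol q A v \<alpha>) = T2 \<alpha> v"
  unfolding breg_sol_eq[OF assms] A_diag[OF T2_div_lp(2)[OF assms]]
  using lam_pos by (auto simp: less_imp_neq[symmetric])

section \<open>The quasi-optimality functional as a series\<close>

abbreviation qo :: "real \<Rightarrow> rseq \<Rightarrow> nat \<Rightarrow> real" where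
  "qo \<alpha> v n \<equiv> quasi_opt (q - 1) (kappa \<alpha> n) (v n)"

text \<open>In the difference of the two dual elements the first residual cancels, leaving the
  second residual \<open>v n - T2 \<alpha> v n\<close>; the factor \<open>\<alpha>\<close> removes
  the \<open>1 / \<alpha>\<close> of both.\<close>

lemma qo_sums_psi_SQO:
  assumes "0 < \<alpha>" "v \<in> lp 2"
  shows "qo \<alpha> v sums (\<alpha> * psi_SQO q A \<alpha> v)"
proof -
  note l2 = T1_lp_2[OF assms] T2_div_lp[OF assms]
  have "(\<lambda>n. T2 \<alpha> v n / lam n - T1 \<alpha> v n / lam n) \<in> lp q"
    using l2 T1_div_lp[OF assms] q by (intro lp_diff) auto
  from A_diag[OF this]
  have d: "A (\<lambda>n. T2 \<alpha> v n / lam n - T1 \<alpha> v n / lam n) = (\<lambda>n. T2 \<alpha> v n - T1 \<alpha> v n)"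
    using lam_pos by (auto simp: field_simps less_imp_neq[symmetric])
  have s: "(\<lambda>n. (T2 \<alpha> v n - v n - (v n - T1 \<alpha> v n)) * (T2 \<alpha> v n - T1 \<alpha> v n)) sums
      (\<Sum>n. (T2 \<alpha> v n - v n - (v n - T1 \<alpha> v n)) * (T2 \<alpha> v n - T1 \<alpha> v n))"
    "(\<lambda>n. (T1 \<alpha> v n - v n) * (T2 \<alpha> v n - T1 \<alpha> v n)) sums
      (\<Sum>n. (T1 \<alpha> v n - v n) * (T2 \<alpha> v n - T1 \<alpha> v n))"
    by (intro summable_sums lp_2_summable_mult lp_diff l2 assms(2); simp)+
  have td: "tik_dual q A v \<alpha> = (\<lambda>h. - (1 / \<alpha>) * l2_inner (\<lambda>n. T1 \<alpha> v n - v n) (A h))"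
    by (simp add: tik_dual_def adj_def A_tik_sol[OF assms])
  have bd: "breg_dual q A v \<alpha>
      = (\<lambda>h. - (1 / \<alpha>) * l2_inner (\<lambda>n. T2 \<alpha> v n - v n - (v n - T1 \<alpha> v n)) (A h))"
    by (simp add: breg_dual_def adj_def A_tik_sol[OF assms] A_breg_sol[OF assms])
  have psi: "\<alpha> * psi_SQO q A \<alpha> v =
      (\<Sum>n. (T1 \<alpha> v n - v n) * (T2 \<alpha> v n - T1 \<alpha> v n)) -
      (\<Sum>n. (T2 \<alpha> v n - v n - (v n - T1 \<alpha> v n)) * (T2 \<alpha> v n - T1 \<alpha> v n))"
    using assms(1)
    by (simp add: psi_SQO_def sym_bregman_def td bd l2_inner_def
        tik_sol_eq[OF assms] breg_sol_eq[OF assms] d right_diff_distrib)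
  have "qo \<alpha> v = (\<lambda>n. (T1 \<alpha> v n - v n) * (T2 \<alpha> v n - T1 \<alpha> v n)
      - (T2 \<alpha> v n - v n - (v n - T1 \<alpha> v n)) * (T2 \<alpha> v n - T1 \<alpha> v n))"
    by (auto simp: quasi_opt_def T1_def T2_def algebra_simps)
  then show ?thesis unfolding psi using sums_diff[OF s(2,1)] by simp
qed

end

section \<open>Data error, approximation error and convergence\<close>

text \<open>A bridge between the unordered sums of the noise condition and the series for
  \<open>psi_SQO\<close>. Summability is part of the conclusion because \<open>infsum\<close>
  defaults to \<open>0\<close> without it.\<close>

lemma infsum_le_suminf:
  fixes f g :: "nat \<Rightarrow> real"
  assumes "summable g" "\<And>n. 0 \<le> g n" "\<And>n. n \<in> S \<Longrightarrow> 0 \<le> f n" "\<And>n. n \<in> S \<Longrightarrow> f n \<le> g n"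
  shows "f summable_on S" "infsum f S \<le> suminf g"
proof -
  have g: "g summable_on UNIV"
    using assms by (simp add: summable_on_UNIV_nonneg_real_iff)
  then have gS: "g summable_on S" by (rule summable_on_subset_banach) simp
  show f: "f summable_on S"
    by (rule summable_on_comparison_test[OF gS]) (use assms in auto)
  have "infsum f S \<le> infsum g S" by (rule infsum_mono[OF f gS]) (use assms in auto)
  also have "\<dots> \<le> infsum g UNIV"
    by (rule infsum_mono_neutral[OF gS g]) (use assms in auto)
  also have "\<dots> = suminf g"
    using g by (metis has_sum_imp_sums has_sum_infsum sums_unique)
  finally show "infsum f S \<le> suminf g" .
qed

context diagonal_operator
begin

text \<open>The summand of \<open>\<alpha>\<close> times the symmetric Bregman distance of the regularised solutions for
  the data \<open>y\<close> and \<open>z\<close>.\<close>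

definition data_error :: "real \<Rightarrow> rseq \<Rightarrow> rseq \<Rightarrow> nat \<Rightarrow> real" where
  "data_error \<alpha> y z n = (T1 \<alpha> y n - T1 \<alpha> z n) * ((y n - T1 \<alpha> y n) - (z n - T1 \<alpha> z n))"

lemma data_error_bounds:
  assumes "0 < \<alpha>"
  shows "0 \<le> data_error \<alpha> y z n" "data_error \<alpha> y z n \<le> (y n - z n)\<^sup>2"
proof -
  note l = resolvent_lipschitz[OF q1 kappa_pos[OF assms, of n], of "y n" "z n"]
  show "0 \<le> data_error \<alpha> y z n"
    using resolvent_monotone[OF q1 kappa_pos[OF assms, of n], of "y n" "z n"]
    by (simp add: data_error_def T1_def)
  have "data_error \<alpha> y z n \<le> \<bar>data_error \<alpha> y z n\<bar>" by simp
  also have "\<dots> \<le> \<bar>y n - z n\<bar> * \<bar>y n - z n\<bar>"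
    unfolding data_error_def abs_mult T1_def using l by (intro mult_mono) auto
  finally show "data_error \<alpha> y z n \<le> (y n - z n)\<^sup>2" by (simp add: power2_eq_square)
qed

lemma data_error_summable:
  assumes "0 < \<alpha>" "y \<in> lp 2" "z \<in> lp 2"
  shows "summable (data_error \<alpha> y z)"
proof -
  have "summable (\<lambda>n. (y n - z n)\<^sup>2)"
    using lp_diff[OF _ assms(2,3)] by (simp add: lp_2_iff)
  then show ?thesis
    by (rule summable_comparison_test') (use data_error_bounds[OF assms(1)] in auto)
qed

text \<open>The quotient compares the upper bound \<open>4 * (m\<^sup>2 * r powr (1 / k))\<close>
  with the lower bound for \<open>quasi_opt\<close>. The summand \<open>1\<close> accounts for
  indices with small \<open>r\<close>, the other for those with large \<open>r\<close>.\<close>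

definition noise_const :: "real \<Rightarrow> real \<Rightarrow> real" where
  "noise_const C1 C2 = 4 / quasi_opt_const (q - 1) * (large_const (q - 1) C1 * C2 + 1)"

lemma noise_const_nonneg: "0 < C2 \<Longrightarrow> 0 \<le> noise_const C1 C2"
  using quasi_opt_const_pos[OF q1] large_const_nonneg[OF q1, of C1] by (simp add: noise_const_def)

text \<open>Indices are split at \<open>r = C1\<close>. Below, the data error is dominated summand
  by summand; above, it is dominated by the first sum of the noise condition, which that condition
  bounds by a sum over small \<open>r\<close>.\<close>

lemma data_error_le_psi:
  assumes \<alpha>: "0 < \<alpha>" and y: "y \<in> lp 2" and z: "z \<in> lp 2"
    and C1: "0 < C1" "C1 \<le> small_threshold (q - 1)" and C2: "0 < C2"
    and noise: "noise_condition q lam A y z \<alpha> C1 C2 C3"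
  shows "suminf (data_error \<alpha> y z) \<le> noise_const C1 C2 * (\<alpha> * (psi_SQO q A \<alpha> y + psi_SQO q A \<alpha> z))"
proof -
  let ?k = "q - 1"
  define m where "m = (\<lambda>n. max \<bar>y n\<bar> \<bar>z n\<bar>)"
  define r where "r = (\<lambda>n. lam n powr q / \<alpha> * m n powr (2 - q))"
  define c where "c = 4 / quasi_opt_const ?k"
  define Q where "Q = (\<lambda>n. c * (qo \<alpha> y n + qo \<alpha> z n))"
  define g where "g = (\<lambda>n. \<bar>y n - z n\<bar>\<^sup>2 * m n powr (q - 2) * (\<alpha> / lam n powr q))"
  define h where "h = (\<lambda>n. (lam n powr q * m n powr (2 - q) / \<alpha>) powr (1 / (q - 1)) * \<bar>y n - z n\<bar>\<^sup>2)"
  define J where "J = I2 q A y z \<alpha> C3"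
  let ?L = "{n. r n \<ge> C1}" and ?S = "{n. r n < C1}"
  have noise': "infsum g ?L + (\<Sum>\<^sub>\<infinity>n\<in>{n. r n \<le> C1} \<inter> - J. \<bar>y n - z n\<bar>\<^sup>2) \<le> C2 * infsum h (?S \<inter> J)"
    using noise unfolding noise_condition_def Let_def g_def h_def r_def m_def J_def .
  note kp = kappa_pos[OF \<alpha>]
  have c0: "0 < c" unfolding c_def using quasi_opt_const_pos[OF q1] by simp
  have r_eq: "r n = m n powr (1 - ?k) / kappa \<alpha> n" for n
    by (simp add: r_def)
  have Q: "Q sums (c * (\<alpha> * psi_SQO q A \<alpha> y + \<alpha> * psi_SQO q A \<alpha> z))"
    unfolding Q_def by (intro sums_mult sums_add qo_sums_psi_SQO \<alpha> y z)
  have qo0: "0 \<le> qo \<alpha> y n" "0 \<le> qo \<alpha> z n" for n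
    using quasi_opt_bounds(1)[OF q1 kp] by auto
  have Q0: "0 \<le> Q n" for n unfolding Q_def using c0 qo0[of n] by simp
  have abs_m: "\<bar>y n\<bar> \<le> m n" "\<bar>z n\<bar> \<le> m n" for n by (auto simp: m_def)
  have small: "4 * ((m n)\<^sup>2 * r n powr (1 / ?k)) \<le> Q n" if "r n < C1" "0 < m n" for n
  proof -
    have "quasi_opt_const ?k * ((m n)\<^sup>2 * r n powr (1 / ?k)) \<le> quasi_opt ?k (kappa \<alpha> n) (m n)"
      using that C1 by (intro quasi_opt_ge[OF q1 kp that(2) r_eq]) auto
    \<comment> \<open>The maximum is attained by one of the two data, and \<open>quasi_opt\<close>
      is even and nonnegative.\<close>
    also have "\<dots> \<le> qo \<alpha> y n + qo \<alpha> z n"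
      using qo0[of n] quasi_opt_abs[OF q1 kp] by (auto simp: m_def max_def)
    finally have "c * (quasi_opt_const ?k * ((m n)\<^sup>2 * r n powr (1 / ?k))) \<le> Q n"
      unfolding Q_def using c0 by (intro mult_left_mono) auto
    then show ?thesis using quasi_opt_const_pos[OF q1] by (simp add: c_def)
  qed
  have zero: "y n = 0" "z n = 0" if "\<not> 0 < m n" for n
    using that by (auto simp: m_def)
  have err_small: "data_error \<alpha> y z n \<le> Q n" if "n \<in> ?S" for n
  proof (cases "0 < m n")
    case True
    have "data_error \<alpha> y z n \<le> 4 * ((m n)\<^sup>2 * r n powr (1 / ?k))"
      unfolding data_error_def T1_def
      by (rule resolv_product_small[OF q1 kp True abs_m r_eq])
    then show ?thesis using small[OF _ True] that by simp
  next
    case False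
    then show ?thesis
      using zero[OF False] Q0[of n] data_error_bounds(2)[OF \<alpha>, of y z n] by simp
  qed
  have h_small: "h n \<le> Q n" if "n \<in> ?S \<inter> J" for n
  proof (cases "0 < m n")
    case True
    \<comment> \<open>The square of \<open>2 * m n\<close> produces the same factor \<open>4\<close>
      as in the bound for the data error.\<close>
    have "\<bar>y n - z n\<bar>\<^sup>2 \<le> (2 * m n)\<^sup>2"
      using abs_m[of n] by (intro power_mono) auto
    then have "h n \<le> r n powr (1 / ?k) * (2 * m n)\<^sup>2"
      unfolding h_def r_def by (simp add: mult_left_mono)
    then show ?thesis using small[OF _ True] that by (simp add: power2_eq_square mult_ac)
  next
    case False
    then show ?thesis using zero[OF False] Q0[of n] by (simp add: h_def)
  qed
  have m_pos: "0 < m n" if "n \<in> ?L" for n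
  proof (rule ccontr)
    assume "\<not> 0 < m n"
    then have "m n = 0" using abs_m(1)[of n] by simp
    then show False using that C1 by (simp add: r_def)
  qed
  have err_large: "data_error \<alpha> y z n \<le> large_const ?k C1 * g n" if "n \<in> ?L" for n
  proof -
    have "data_error \<alpha> y z n
        \<le> large_const ?k C1 * ((y n - z n)\<^sup>2 * m n powr (?k - 1) * kappa \<alpha> n)"
      unfolding data_error_def T1_def
      using that C1 by (intro resolv_product_large[OF q1 kp _ m_pos[OF that] r_eq]) (auto simp: m_def)
    then show ?thesis by (simp add: g_def)
  qed
  have yz: "summable (\<lambda>n. (y n - z n)\<^sup>2)" using lp_diff[OF _ y z] by (simp add: lp_2_iff)
  have g_le: "g n \<le> 1 / C1 * (y n - z n)\<^sup>2" if "n \<in> ?L" for n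
  proof -
    have "m n powr (q - 2) * kappa \<alpha> n = 1 / r n"
      using m_pos[OF that] lam_pos[of n] \<alpha> by (simp add: r_def powr_diff field_simps)
    also have "\<dots> \<le> 1 / C1" using that C1 by (intro divide_left_mono) auto
    finally have "m n powr (q - 2) * kappa \<alpha> n * (y n - z n)\<^sup>2 \<le> 1 / C1 * (y n - z n)\<^sup>2"
      by (rule mult_right_mono) simp
    then show ?thesis by (simp add: g_def mult_ac)
  qed
  have g0: "0 \<le> g n" for n unfolding g_def using \<alpha> by simp
  \<comment> \<open>Without true summability the default value \<open>0\<close> of
    \<open>infsum g ?L\<close> would make the bound on it worthless.\<close>
  have gL: "g summable_on ?L"
    by (rule infsum_le_suminf(1)[OF summable_mult[OF yz, of "1 / C1"]])
      (use g_le g0 C1 in auto)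
  have E0: "0 \<le> data_error \<alpha> y z n" for n by (rule data_error_bounds[OF \<alpha>])
  have E: "data_error \<alpha> y z summable_on UNIV"
    using data_error_summable[OF \<alpha> y z] E0 by (simp add: summable_on_UNIV_nonneg_real_iff)
  then have EL: "data_error \<alpha> y z summable_on ?L" and ES: "data_error \<alpha> y z summable_on ?S"
    by (auto intro: summable_on_subset_banach)
  have sQ: "suminf Q = c * (\<alpha> * (psi_SQO q A \<alpha> y + psi_SQO q A \<alpha> z))"
    using sums_unique[OF Q] by (simp add: distrib_left)
  have "infsum h (?S \<inter> J) \<le> suminf Q"
    by (rule infsum_le_suminf(2)[OF sums_summable[OF Q]]) (use Q0 h_small in \<open>auto simp: h_def\<close>)
  then have "C2 * infsum h (?S \<inter> J) \<le> C2 * suminf Q" using C2 by simp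
  moreover have "0 \<le> (\<Sum>\<^sub>\<infinity>n\<in>{n. r n \<le> C1} \<inter> - J. \<bar>y n - z n\<bar>\<^sup>2)"
    by (rule infsum_nonneg) simp
  ultimately have gC: "infsum g ?L \<le> C2 * suminf Q" using noise' by linarith
  have "suminf (data_error \<alpha> y z) = infsum (data_error \<alpha> y z) UNIV"
    using E by (metis has_sum_imp_sums has_sum_infsum sums_unique)
  also have "UNIV = ?L \<union> ?S" by auto
  also have "infsum (data_error \<alpha> y z) (?L \<union> ?S)
      = infsum (data_error \<alpha> y z) ?L + infsum (data_error \<alpha> y z) ?S"
    by (intro infsum_Un_disjoint EL ES) auto
  also have "infsum (data_error \<alpha> y z) ?S \<le> suminf Q"
    by (rule infsum_le_suminf(2)[OF sums_summable[OF Q]]) (use Q0 E0 err_small in auto)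
  also have "infsum (data_error \<alpha> y z) ?L \<le> infsum (\<lambda>n. large_const ?k C1 * g n) ?L"
    by (intro infsum_mono EL summable_on_cmult_right gL err_large)
  also have "\<dots> = large_const ?k C1 * infsum g ?L"
    by (rule infsum_cmult_right) (use gL in auto)
  also have "\<dots> \<le> large_const ?k C1 * (C2 * suminf Q)"
    using gC large_const_nonneg[OF q1] by (intro mult_left_mono) auto
  finally have "suminf (data_error \<alpha> y z) \<le> large_const ?k C1 * (C2 * suminf Q) + suminf Q"
    by simp
  also have "\<dots> = noise_const C1 C2 * (\<alpha> * (psi_SQO q A \<alpha> y + psi_SQO q A \<alpha> z))"
    by (simp add: sQ noise_const_def algebra_simps flip: c_def)
  finally show ?thesis .
qed

section \<open>Consequences of the source condition\<close>

lemma source_condition_pointwise: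
  assumes w: "w \<in> lp 2" and x: "x \<in> lp q" and sub: "adj A w \<in> subdifferential q (Reg q) x"
  shows "lam n * w n = spow (q - 1) (x n)"
proof (rule powr_subgradient_unique[OF q])
  fix s
  \<comment> \<open>Varying a single coordinate turns the subgradient inequality in the sequence
    space into a scalar one.\<close>
  let ?e = "\<lambda>k. if k = n then s - x n else 0"
  have e: "?e \<in> lp q" by (rule lp_finite_support[of "{n}"]) auto
  have z: "(\<lambda>k. x k + ?e k) \<in> lp q" using x e q by (intro lp_add) auto
  have "Reg q x + adj A w (\<lambda>k. (x k + ?e k) - x k) \<le> Reg q (\<lambda>k. x k + ?e k)"
  proof -
    have "\<And>z. z \<in> lp q \<Longrightarrow> Reg q x + adj A w (\<lambda>k. z k - x k) \<le> Reg q z"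
      using sub by (simp add: subdifferential_def)
    from this[OF z] show ?thesis .
  qed
  moreover have "adj A w (\<lambda>k. (x k + ?e k) - x k) = lam n * w n * (s - x n)"
  proof -
    have "(\<lambda>k. w k * (lam k * ?e k)) = (\<lambda>k. if k = n then w k * (lam k * (s - x n)) else 0)"
      by auto
    then have "(\<Sum>k. w k * (lam k * ?e k)) = w n * (lam n * (s - x n))"
      using sums_unique[OF sums_If_finite_set[of "{n}" "\<lambda>k. w k * (lam k * (s - x n))"]]
      by (simp add: fun_eq_iff)
    then show ?thesis by (simp add: adj_def l2_inner_def A_diag[OF e])
  qed
  moreover have "Reg q (\<lambda>k. x k + ?e k) - Reg q x = (\<bar>s\<bar> powr q - \<bar>x n\<bar> powr q) / q"
  proof -
    have "(\<lambda>k. \<bar>x k + ?e k\<bar> powr q - \<bar>x k\<bar> powr q)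
        = (\<lambda>k. if k \<in> {n} then \<bar>s\<bar> powr q - \<bar>x n\<bar> powr q else 0)" by auto
    moreover have "(\<lambda>k. \<bar>x k + ?e k\<bar> powr q - \<bar>x k\<bar> powr q) sums
        ((\<Sum>k. \<bar>x k + ?e k\<bar> powr q) - (\<Sum>k. \<bar>x k\<bar> powr q))"
      using x z by (intro sums_diff summable_sums) (auto simp: lp_def)
    ultimately have "(\<Sum>k. \<bar>x k + ?e k\<bar> powr q) - (\<Sum>k. \<bar>x k\<bar> powr q) = \<bar>s\<bar> powr q - \<bar>x n\<bar> powr q"
      using sums_unique2 sums_If_finite_set[of "{n}" "\<lambda>_. \<bar>s\<bar> powr q - \<bar>x n\<bar> powr q"] by simp
    then show ?thesis
      unfolding Reg_eq[OF x] Reg_eq[OF z] by (simp flip: diff_divide_distrib)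
  qed
  ultimately show "\<bar>x n\<bar> powr q / q + lam n * w n * (s - x n) \<le> \<bar>s\<bar> powr q / q"
    using q by (simp add: diff_divide_distrib)
qed

text \<open>Stationarity equates \<open>lam n\<close> times the residual with
  \<open>\<alpha>\<close> times a signed power of the solution. The solution is no larger in modulus
  than \<open>x n\<close>, whose signed power is \<open>lam n * w n\<close>.\<close>

lemma residual_le_source:
  assumes \<alpha>: "0 < \<alpha>" and src: "lam n * w n = spow (q - 1) (x n)"
  shows "\<bar>lam n * x n - T1 \<alpha> (\<lambda>n. lam n * x n) n\<bar> \<le> \<alpha> * \<bar>w n\<bar>"
proof -
  let ?T = "T1 \<alpha> (\<lambda>n. lam n * x n) n"
  have l: "0 < lam n" by (rule lam_pos)
  have "\<bar>?T / lam n\<bar> \<le> \<bar>x n\<bar>"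
    using T1_bounds(1)[OF \<alpha>, of "\<lambda>n. lam n * x n" n] l by (simp add: abs_mult field_simps)
  then have "\<bar>?T / lam n\<bar> powr (q - 1) \<le> \<bar>x n\<bar> powr (q - 1)"
    using q by (intro powr_mono2) auto
  moreover have abs_spow: "\<bar>spow (q - 1) a\<bar> = \<bar>a\<bar> powr (q - 1)" for a
    by (cases "a = 0") (auto simp: spow_def abs_mult abs_sgn_eq)
  ultimately have "\<alpha> * \<bar>spow (q - 1) (?T / lam n)\<bar> \<le> \<alpha> * \<bar>lam n * w n\<bar>"
    using \<alpha> by (simp only: src abs_spow) simp
  moreover have "\<alpha> * \<bar>spow (q - 1) (?T / lam n)\<bar> = \<bar>\<alpha> * spow (q - 1) (?T / lam n)\<bar>"
    using \<alpha> by (simp add: abs_mult)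
  ultimately have "lam n * \<bar>lam n * x n - ?T\<bar> \<le> lam n * (\<alpha> * \<bar>w n\<bar>)"
    unfolding spow_T1_div[OF \<alpha>] using l by (simp add: abs_mult mult_ac)
  then show ?thesis using l by simp
qed

text \<open>With \<open>p\<close> the residual for exact data and \<open>dp\<close>,
  \<open>du\<close> the effects of the noise on residual and fit, the symmetric Bregman distance has
  summand \<open>1 / \<alpha> * ((dp + (p - \<alpha> * w n)) * (du - p))\<close>. Here
  \<open>dp * du\<close> is the data error, and all other terms contain \<open>p\<close> or
  \<open>p - \<alpha> * w n\<close>, both bounded by multiples of
  \<open>\<alpha> * \<bar>w n\<bar>\<close>.\<close>

lemma bregman_le_data_error:
  assumes \<alpha>: "0 < \<alpha>" and \<delta>: "0 < \<delta>" and w: "w \<in> lp 2" and x: "x \<in> lp q" and z: "z \<in> lp 2"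
    and src: "\<And>n. lam n * w n = spow (q - 1) (x n)"
    and y: "y = (\<lambda>n. lam n * x n)"
    and noise: "(\<Sum>n. (y n - z n)\<^sup>2) \<le> \<delta>\<^sup>2"
  shows "bregman (Reg q) (adj A w) (tik_sol q A z \<alpha>) x
     \<le> 1 / \<alpha> * suminf (data_error \<alpha> y z) + 2 * \<delta> + 2 * (\<delta> + \<alpha>) * (\<Sum>n. (w n)\<^sup>2)"
proof -
  let ?X = "\<lambda>n. T1 \<alpha> z n / lam n"
  note X = T1_div_lp[OF \<alpha> z]
  have y2: "y \<in> lp 2" unfolding y by (rule diag_lp[OF x])
  have Xx: "(\<lambda>n. ?X n - x n) \<in> lp q" using X x q by (intro lp_diff) auto
  have AXx: "A (\<lambda>n. ?X n - x n) = (\<lambda>n. T1 \<alpha> z n - y n)"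
    unfolding A_diag[OF Xx] y using lam_pos by (auto simp: field_simps less_imp_neq[symmetric])
  have s1: "(\<lambda>n. 1 / q * \<bar>?X n\<bar> powr q - 1 / q * \<bar>x n\<bar> powr q - w n * (T1 \<alpha> z n - y n)) sums
      bregman (Reg q) (adj A w) (tik_sol q A z \<alpha>) x"
    unfolding bregman_def tik_sol_eq[OF \<alpha> z] Reg_eq[OF X] Reg_eq[OF x] adj_def l2_inner_def AXx
    using X x T1_lp_2[OF \<alpha> z] y2 w
    by (intro sums_diff sums_mult summable_sums lp_2_summable_mult lp_diff) (auto simp: lp_def)
  have yz: "summable (\<lambda>n. (y n - z n)\<^sup>2)" using lp_diff[OF _ y2 z] by (simp add: lp_2_iff)
  have s2: "(\<lambda>n. 1 / \<alpha> * data_error \<alpha> y z n + 2 * (1 / \<delta> * (y n - z n)\<^sup>2) + 2 * (\<delta> + \<alpha>) * (w n)\<^sup>2) sums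
     (1 / \<alpha> * suminf (data_error \<alpha> y z) + 2 * (1 / \<delta> * (\<Sum>n. (y n - z n)\<^sup>2))
       + 2 * (\<delta> + \<alpha>) * (\<Sum>n. (w n)\<^sup>2))"
    using w by (intro sums_add sums_mult summable_sums data_error_summable \<alpha> y2 z yz) (simp add: lp_2_iff)
  have "bregman (Reg q) (adj A w) (tik_sol q A z \<alpha>) x
     \<le> 1 / \<alpha> * suminf (data_error \<alpha> y z) + 2 * (1 / \<delta> * (\<Sum>n. (y n - z n)\<^sup>2))
       + 2 * (\<delta> + \<alpha>) * (\<Sum>n. (w n)\<^sup>2)"
  proof (rule sums_le[OF _ s1 s2])
    fix n
    define u where "u = T1 \<alpha> y n"
    define u' where "u' = T1 \<alpha> z n"
    define p where "p = y n - u"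
    define dp where "dp = (z n - u') - p"
    define du where "du = u' - u"
    define d where "d = \<bar>y n - z n\<bar>"
    have lip: "\<bar>dp\<bar> \<le> d" "\<bar>du\<bar> \<le> d"
      using resolvent_lipschitz[OF q1 kappa_pos[OF \<alpha>, of n], of "z n" "y n"]
      by (auto simp: dp_def du_def p_def d_def u_def u'_def T1_def)
    have pw: "\<bar>p\<bar> \<le> \<alpha> * \<bar>w n\<bar>"
      using residual_le_source[of \<alpha> n w x, OF \<alpha> src] by (simp add: p_def u_def y)
    \<comment> \<open>Convexity bounds the Bregman distance by its symmetric version.\<close>
    have "1 / q * \<bar>?X n\<bar> powr q - 1 / q * \<bar>x n\<bar> powr q \<le> spow (q - 1) (?X n) * (?X n - x n)"
      using powr_subgradient[OF q, of "?X n" "x n"] by (simp add: algebra_simps)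
    also have "spow (q - 1) (?X n) = lam n * (z n - u') / \<alpha>"
      using spow_T1_div[OF \<alpha>, of z n] \<alpha> by (simp add: u'_def field_simps)
    also have "lam n * (z n - u') / \<alpha> * (?X n - x n) = 1 / \<alpha> * ((p + dp) * (du - p))"
    proof -
      have "lam n * (?X n - x n) = du - p"
        using lam_pos[of n] by (simp add: du_def p_def u'_def y field_simps)
      moreover have "z n - u' = p + dp" by (simp add: dp_def)
      ultimately show ?thesis by (metis mult.assoc mult.commute mult_1 times_divide_eq_left)
    qed
    finally have "1 / q * \<bar>?X n\<bar> powr q - 1 / q * \<bar>x n\<bar> powr q - w n * (T1 \<alpha> z n - y n)
        \<le> 1 / \<alpha> * ((p + dp) * (du - p)) - w n * (du - p)"
      by (simp add: du_def p_def u'_def)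
    also have "\<dots> = 1 / \<alpha> * ((dp + (p - \<alpha> * w n)) * (du - p))"
      using \<alpha> by (simp add: field_simps)
    also have "(dp + (p - \<alpha> * w n)) * (du - p)
        \<le> dp * du + (\<bar>dp\<bar> * \<bar>p\<bar> + \<bar>p - \<alpha> * w n\<bar> * \<bar>du\<bar> + \<bar>p - \<alpha> * w n\<bar> * \<bar>p\<bar>)"
    proof -
      have "- (dp * p) \<le> \<bar>dp\<bar> * \<bar>p\<bar>" "(p - \<alpha> * w n) * du \<le> \<bar>p - \<alpha> * w n\<bar> * \<bar>du\<bar>"
        "- ((p - \<alpha> * w n) * p) \<le> \<bar>p - \<alpha> * w n\<bar> * \<bar>p\<bar>"
        unfolding abs_mult[symmetric] by (auto intro: order_trans[OF _ abs_ge_self] abs_ge_minus_self)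
      moreover have "(dp + (p - \<alpha> * w n)) * (du - p)
          = dp * du + - (dp * p) + (p - \<alpha> * w n) * du + - ((p - \<alpha> * w n) * p)"
        by (simp add: algebra_simps)
      ultimately show ?thesis by linarith
    qed
    also have "dp * du = data_error \<alpha> y z n"
      by (simp add: data_error_def dp_def du_def p_def u_def u'_def algebra_simps)
    also have "\<bar>dp\<bar> * \<bar>p\<bar> + \<bar>p - \<alpha> * w n\<bar> * \<bar>du\<bar> + \<bar>p - \<alpha> * w n\<bar> * \<bar>p\<bar>
        \<le> d * (\<alpha> * \<bar>w n\<bar>) + (2 * \<alpha> * \<bar>w n\<bar>) * d + (2 * \<alpha> * \<bar>w n\<bar>) * (\<alpha> * \<bar>w n\<bar>)"
    proof -
      have "\<bar>p - \<alpha> * w n\<bar> \<le> \<bar>p\<bar> + \<bar>\<alpha> * w n\<bar>" by (rule abs_triangle_ineq4)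
      also have "\<dots> \<le> 2 * \<alpha> * \<bar>w n\<bar>" using pw \<alpha> by (simp add: abs_mult)
      finally show ?thesis using lip pw \<alpha> by (intro add_mono mult_mono) auto
    qed
    also have "\<dots> = \<alpha> * (3 * (d * \<bar>w n\<bar>) + 2 * \<alpha> * (w n)\<^sup>2)"
      by (simp add: power2_eq_square algebra_simps)
    finally have le: "1 / q * \<bar>?X n\<bar> powr q - 1 / q * \<bar>x n\<bar> powr q - w n * (T1 \<alpha> z n - y n)
        \<le> 1 / \<alpha> * data_error \<alpha> y z n + (3 * (d * \<bar>w n\<bar>) + 2 * \<alpha> * (w n)\<^sup>2)"
      using \<alpha> by (simp add: field_simps)
    \<comment> \<open>Weight \<open>\<delta>\<close> balances the terms: the squared noise, divided
      by \<open>\<delta>\<close>, still sums to at most \<open>\<delta>\<close>.\<close>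
    have "2 * (d * \<bar>w n\<bar>) \<le> 1 / \<delta> * d\<^sup>2 + \<delta> * (w n)\<^sup>2"
    proof -
      have "0 \<le> 1 / \<delta> * (d - \<delta> * \<bar>w n\<bar>)\<^sup>2" using \<delta> by simp
      also have "\<dots> = 1 / \<delta> * d\<^sup>2 + \<delta> * (w n)\<^sup>2 - 2 * (d * \<bar>w n\<bar>)"
        using \<delta> by (simp add: power2_diff power_mult_distrib field_simps power2_eq_square)
      finally show ?thesis by simp
    qed
    moreover have "0 \<le> d * \<bar>w n\<bar>" by (simp add: d_def)
    moreover have "d\<^sup>2 = (y n - z n)\<^sup>2" by (simp add: d_def)
    ultimately show "1 / q * \<bar>?X n\<bar> powr q - 1 / q * \<bar>x n\<bar> powr q - w n * (T1 \<alpha> z n - y n)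
        \<le> 1 / \<alpha> * data_error \<alpha> y z n + 2 * (1 / \<delta> * (y n - z n)\<^sup>2) + 2 * (\<delta> + \<alpha>) * (w n)\<^sup>2"
      using le by (simp only: distrib_right distrib_left)
  qed
  moreover have "1 / \<delta> * (\<Sum>n. (y n - z n)\<^sup>2) \<le> 1 / \<delta> * \<delta>\<^sup>2"
    using noise \<delta> by (intro mult_left_mono) auto
  moreover have "1 / \<delta> * \<delta>\<^sup>2 = \<delta>" using \<delta> by (simp add: power2_eq_square)
  ultimately show ?thesis by linarith
qed

section \<open>Upper and lower bounds for the quasi-optimality functional\<close>

lemma psi_SQO_nonneg: "0 < \<alpha> \<Longrightarrow> v \<in> lp 2 \<Longrightarrow> 0 \<le> psi_SQO q A \<alpha> v"
proof -
  assume *: "0 < \<alpha>" "v \<in> lp 2"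
  have "0 \<le> \<alpha> * psi_SQO q A \<alpha> v"
    by (rule sums_le[OF _ sums_zero qo_sums_psi_SQO[OF *]])
      (use quasi_opt_bounds(1)[OF q1 kappa_pos[OF *(1)]] in auto)
  then show ?thesis using *(1) by (simp add: zero_le_mult_iff)
qed

lemma psi_SQO_ge_summand:
  assumes "0 < \<alpha>" "v \<in> lp 2"
  shows "qo \<alpha> v n \<le> \<alpha> * psi_SQO q A \<alpha> v"
proof -
  note s = qo_sums_psi_SQO[OF assms]
  have "sum (qo \<alpha> v) {n} \<le> suminf (qo \<alpha> v)"
    using quasi_opt_bounds(1)[OF q1 kappa_pos[OF assms(1)]]
    by (intro sum_le_suminf sums_summable[OF s]) auto
  then show ?thesis using sums_unique[OF s] by simp
qed

text \<open>Each summand is at most the squared residual for \<open>z\<close>, which differs from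
  the residual for \<open>y\<close> by at most the noise; the latter is at most
  \<open>\<alpha> * \<bar>w n\<bar>\<close>.\<close>

lemma psi_SQO_le:
  assumes \<alpha>: "0 < \<alpha>" and w: "w \<in> lp 2" and x: "x \<in> lp q" and z: "z \<in> lp 2"
    and src: "\<And>n. lam n * w n = spow (q - 1) (x n)"
    and y: "y = (\<lambda>n. lam n * x n)"
    and noise: "(\<Sum>n. (y n - z n)\<^sup>2) \<le> \<delta>\<^sup>2"
  shows "psi_SQO q A \<alpha> z \<le> 2 * \<alpha> * (\<Sum>n. (w n)\<^sup>2) + 2 * \<delta>\<^sup>2 / \<alpha>"
proof -
  have y2: "y \<in> lp 2" unfolding y by (rule diag_lp[OF x])
  have yz: "summable (\<lambda>n. (y n - z n)\<^sup>2)" using lp_diff[OF _ y2 z] by (simp add: lp_2_iff)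
  have s: "(\<lambda>n. 2 * \<alpha>\<^sup>2 * (w n)\<^sup>2 + 2 * (y n - z n)\<^sup>2) sums
      (2 * \<alpha>\<^sup>2 * (\<Sum>n. (w n)\<^sup>2) + 2 * (\<Sum>n. (y n - z n)\<^sup>2))"
    using w yz by (intro sums_add sums_mult summable_sums) (auto simp: lp_2_iff)
  have "\<alpha> * psi_SQO q A \<alpha> z \<le> 2 * \<alpha>\<^sup>2 * (\<Sum>n. (w n)\<^sup>2) + 2 * (\<Sum>n. (y n - z n)\<^sup>2)"
  proof (rule sums_le[OF _ qo_sums_psi_SQO[OF \<alpha> z] s])
    fix n
    define p where "p = y n - T1 \<alpha> y n"
    define p' where "p' = z n - T1 \<alpha> z n"
    have "\<bar>p' - p\<bar> \<le> \<bar>y n - z n\<bar>"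
      using resolvent_lipschitz(2)[OF q1 kappa_pos[OF \<alpha>, of n], of "z n" "y n"]
      by (simp add: p_def p'_def T1_def)
    then have 1: "(p' - p)\<^sup>2 \<le> (y n - z n)\<^sup>2" by (simp add: abs_le_square_iff)
    have "\<bar>p\<bar> \<le> \<bar>\<alpha> * w n\<bar>"
      using residual_le_source[of \<alpha> n w x, OF \<alpha> src] \<alpha> by (simp add: p_def y abs_mult)
    then have 2: "p\<^sup>2 \<le> \<alpha>\<^sup>2 * (w n)\<^sup>2" by (simp add: abs_le_square_iff power_mult_distrib)
    have "qo \<alpha> z n \<le> p'\<^sup>2"
      using quasi_opt_bounds(2)[OF q1 kappa_pos[OF \<alpha>, of n], of "z n"] by (simp add: p'_def T1_def)
    also have "\<dots> \<le> 2 * p\<^sup>2 + 2 * (p' - p)\<^sup>2"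
      using zero_le_power2[of "2 * p - p'"] by (simp add: power2_eq_square algebra_simps)
    finally show "qo \<alpha> z n \<le> 2 * \<alpha>\<^sup>2 * (w n)\<^sup>2 + 2 * (y n - z n)\<^sup>2" using 1 2 by simp
  qed
  also have "\<dots> \<le> \<alpha> * (2 * \<alpha> * (\<Sum>n. (w n)\<^sup>2) + 2 * \<delta>\<^sup>2 / \<alpha>)"
    using noise \<alpha> by (simp add: power2_eq_square algebra_simps)
  finally show ?thesis using \<alpha> by simp
qed

text \<open>A nonzero coordinate of the exact data detects large parameters: while
  \<open>\<alpha> \<delta> \<ge> \<eta>\<close>, its \<open>kappa\<close> stays in a compact
  interval and its summand above a positive constant, which is incompatible with
  \<open>psi_SQO\<close> tending to \<open>0\<close>.\<close>

lemma parameter_tendsto_0: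
  fixes z :: "real \<Rightarrow> rseq"
  assumes y: "y n \<noteq> 0"
    and z: "\<And>\<delta>. 0 < \<delta> \<Longrightarrow> z \<delta> \<in> lp 2" "\<And>\<delta>. 0 < \<delta> \<Longrightarrow> \<bar>y n - z \<delta> n\<bar> \<le> \<delta>"
    and \<alpha>: "\<And>\<delta>. 0 < \<delta> \<Longrightarrow> \<alpha> \<delta> \<in> {0<..<\<alpha>max}"
    and psi: "((\<lambda>\<delta>. psi_SQO q A (\<alpha> \<delta>) (z \<delta>)) \<longlongrightarrow> 0) (at_right 0)"
  shows "(\<alpha> \<longlongrightarrow> 0) (at_right 0)"
proof (rule tendstoI)
  fix \<eta> :: real assume \<eta>: "0 < \<eta>"
  let ?I = "{kappa \<eta> n..kappa \<alpha>max n}"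
  have "\<exists>e>0. \<forall>c\<in>?I. \<forall>v. \<bar>v\<bar> \<in> {\<bar>y n\<bar> / 2..2 * \<bar>y n\<bar>} \<longrightarrow> e \<le> quasi_opt (q - 1) c v"
    using y by (intro quasi_opt_lower_bound q1 kappa_pos \<eta>) auto
  then obtain e where e: "0 < e"
    "\<And>c v. c \<in> ?I \<Longrightarrow> \<bar>v\<bar> \<in> {\<bar>y n\<bar> / 2..2 * \<bar>y n\<bar>} \<Longrightarrow> e \<le> quasi_opt (q - 1) c v"
    by blast
  have \<alpha>max: "0 < \<alpha>max" using \<alpha>[of 1] by simp
  have "\<forall>\<^sub>F \<delta> in at_right 0. psi_SQO q A (\<alpha> \<delta>) (z \<delta>) < e / \<alpha>max"
    using psi e(1) \<alpha>max by (intro order_tendstoD) auto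
  moreover have "\<forall>\<^sub>F \<delta> in at_right 0. \<delta> \<in> {0<..<\<bar>y n\<bar> / 2}"
    using y by (intro eventually_at_right_real) auto
  ultimately show "\<forall>\<^sub>F \<delta> in at_right 0. dist (\<alpha> \<delta>) 0 < \<eta>"
  proof eventually_elim
    case (elim \<delta>)
    then have \<delta>: "0 < \<delta>" "\<delta> < \<bar>y n\<bar> / 2" by auto
    note a = \<alpha>[OF \<delta>(1)]
    have "\<alpha> \<delta> < \<eta>"
    proof (rule ccontr)
      assume "\<not> \<alpha> \<delta> < \<eta>"
      then have "kappa (\<alpha> \<delta>) n \<in> ?I"
        using a lam_pos[of n] by (auto intro!: divide_right_mono)
      moreover have "\<bar>z \<delta> n\<bar> \<in> {\<bar>y n\<bar> / 2..2 * \<bar>y n\<bar>}"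
        using z(2)[OF \<delta>(1)] \<delta> by (auto simp: abs_le_iff)
      ultimately have "e \<le> qo (\<alpha> \<delta>) (z \<delta>) n" by (rule e(2))
      also have "\<dots> \<le> \<alpha> \<delta> * psi_SQO q A (\<alpha> \<delta>) (z \<delta>)"
        using a by (intro psi_SQO_ge_summand z \<delta>) auto
      also have "\<dots> \<le> \<alpha>max * psi_SQO q A (\<alpha> \<delta>) (z \<delta>)"
        using a z(1)[OF \<delta>(1)] by (intro mult_right_mono psi_SQO_nonneg) auto
      also have "\<dots> < e"
        using elim(1) \<alpha>max by (simp add: field_simps)
      finally show False by simp
    qed
    then show ?case using a by simp
  qed
qed

lemma heuristic_convergence:
  fixes z :: "real \<Rightarrow> rseq"
  assumes x: "x \<in> lp q" and w: "w \<in> lp 2"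
    and sub: "adj A w \<in> subdifferential q (Reg q) x"
    and \<alpha>max: "0 < \<alpha>max"
    and z: "\<And>\<delta>. 0 < \<delta> \<Longrightarrow> z \<delta> \<in> lp 2"
      "\<And>\<delta>. 0 < \<delta> \<Longrightarrow> lp_norm 2 (\<lambda>n. z \<delta> n - A x n) \<le> \<delta>"
    and \<alpha>: "\<And>\<delta>. 0 < \<delta> \<Longrightarrow>
      is_arg_min (\<lambda>\<alpha>. psi_SQO q A \<alpha> (z \<delta>)) (\<lambda>\<alpha>. \<alpha> \<in> {0<..<\<alpha>max}) (\<alpha> \<delta>)"
    and C1: "0 < C1" "C1 \<le> small_threshold (q - 1)" and C2: "0 < C2"
    and noise: "\<And>\<delta> \<alpha>. 0 < \<delta> \<Longrightarrow> \<alpha> \<in> {0<..<\<alpha>max} \<Longrightarrow>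
      noise_condition q lam A (A x) (z \<delta>) \<alpha> C1 C2 C3"
  shows "((\<lambda>\<delta>. bregman (Reg q) (adj A w) (tik_sol q A (z \<delta>) (\<alpha> \<delta>)) x) \<longlongrightarrow> 0) (at_right 0)"
proof -
  define y where "y = A x"
  define W where "W = (\<Sum>n. (w n)\<^sup>2)"
  define E where "E = (\<lambda>\<delta>. psi_SQO q A (\<alpha> \<delta>) (z \<delta>))"
  define N where "N = noise_const C1 C2"
  have y: "y = (\<lambda>n. lam n * x n)" unfolding y_def by (rule A_diag[OF x])
  have y2: "y \<in> lp 2" unfolding y_def by (rule A_lp[OF x])
  have src: "lam n * w n = spow (q - 1) (x n)" for n
    by (rule source_condition_pointwise[OF w x sub])
  have N0: "0 \<le> N" unfolding N_def by (rule noise_const_nonneg[OF C2])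
  have \<alpha>_in: "\<alpha> \<delta> \<in> {0<..<\<alpha>max}" if "0 < \<delta>" for \<delta>
    using \<alpha>[OF that] unfolding is_arg_min_def by blast
  have zy: "(\<lambda>n. z \<delta> n - y n) \<in> lp 2" if "0 < \<delta>" for \<delta>
    using z(1)[OF that] y2 by (intro lp_diff) auto
  have dist: "(\<Sum>n. (y n - z \<delta> n)\<^sup>2) \<le> \<delta>\<^sup>2" if "0 < \<delta>" for \<delta>
  proof -
    have "(lp_norm 2 (\<lambda>n. z \<delta> n - y n))\<^sup>2 \<le> \<delta>\<^sup>2"
      using z(2)[OF that] by (intro power_mono lp_norm_nonneg) (simp add: y_def)
    then show ?thesis by (simp add: lp_norm_2_sq[OF zy[OF that]] power2_commute)
  qed
  have coord: "\<bar>y n - z \<delta> n\<bar> \<le> \<delta>" if "0 < \<delta>" for \<delta> n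
    using lp_2_coord_le[OF zy[OF that], of n] z(2)[OF that] by (simp add: y_def abs_minus_commute)
  have E: "(E \<longlongrightarrow> 0) (at_right 0)"
  proof (rule tendsto_sandwich)
    \<comment> \<open>For \<open>\<delta> < \<alpha>max\<close> the value \<open>\<delta>\<close> is
      itself an admissible parameter and competes in the minimisation.\<close>
    have ev: "\<forall>\<^sub>F \<delta> in at_right 0. \<delta> \<in> {0<..<\<alpha>max}"
      using \<alpha>max by (intro eventually_at_right_real)
    from ev show "\<forall>\<^sub>F \<delta> in at_right 0. 0 \<le> E \<delta>"
      by eventually_elim (use \<alpha>_in z(1) in \<open>auto simp: E_def intro!: psi_SQO_nonneg\<close>)
    from ev show "\<forall>\<^sub>F \<delta> in at_right 0. E \<delta> \<le> 2 * \<delta> * W + 2 * \<delta>"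
    proof eventually_elim
      case (elim \<delta>)
      then have \<delta>: "0 < \<delta>" by simp
      have "\<not> psi_SQO q A \<delta> (z \<delta>) < E \<delta>"
        using \<alpha>[OF \<delta>] elim unfolding is_arg_min_def E_def by blast
      then have "E \<delta> \<le> psi_SQO q A \<delta> (z \<delta>)" by simp
      also have "\<dots> \<le> 2 * \<delta> * W + 2 * \<delta>\<^sup>2 / \<delta>"
        unfolding W_def by (rule psi_SQO_le[OF \<delta> w x z(1)[OF \<delta>] src y dist[OF \<delta>]])
      finally show ?case using \<delta> by (simp add: power2_eq_square)
    qed
    have "((\<lambda>\<delta>. 2 * \<delta> * W + 2 * \<delta>) \<longlongrightarrow> 2 * 0 * W + 2 * 0) (at_right 0)"
      by (intro tendsto_intros)
    then show "((\<lambda>\<delta>. 2 * \<delta> * W + 2 * \<delta>) \<longlongrightarrow> 0) (at_right 0)" by simp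
  qed simp
  \<comment> \<open>The limit is taken for the product because the parameter itself is controlled
    only if some \<open>y n\<close> is nonzero.\<close>
  have \<alpha>W: "((\<lambda>\<delta>. \<alpha> \<delta> * W) \<longlongrightarrow> 0) (at_right 0)"
  proof (cases "\<exists>n. y n \<noteq> 0")
    case True
    then obtain n where "y n \<noteq> 0" by blast
    from parameter_tendsto_0[of y n, OF this z(1) coord \<alpha>_in E[unfolded E_def]]
    have "(\<alpha> \<longlongrightarrow> 0) (at_right 0)" .
    from tendsto_mult_left_zero[OF this] show ?thesis .
  next
    case False
    then have "lam n * x n = 0" for n unfolding y by blast
    then have "x n = 0" for n using lam_pos[of n] by (metis less_irrefl mult_eq_0_iff)
    then have "w n = 0" for n using src[of n] lam_pos[of n] by simp
    then show ?thesis by (simp add: W_def)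
  qed
  show ?thesis
  proof (rule tendsto_sandwich)
    have ev: "\<forall>\<^sub>F \<delta> in at_right (0::real). 0 < \<delta>"
      by (rule eventually_at_right_less)
    from ev show "\<forall>\<^sub>F \<delta> in at_right 0. 0 \<le> bregman (Reg q) (adj A w) (tik_sol q A (z \<delta>) (\<alpha> \<delta>)) x"
    proof eventually_elim
      case (elim \<delta>)
      have "tik_sol q A (z \<delta>) (\<alpha> \<delta>) \<in> lp q"
        using \<alpha>_in[OF elim] z(1)[OF elim] by (simp add: tik_sol_eq T1_div_lp)
      then show ?case using sub by (auto simp: subdifferential_def bregman_def algebra_simps)
    qed
    from ev show "\<forall>\<^sub>F \<delta> in at_right 0. bregman (Reg q) (adj A w) (tik_sol q A (z \<delta>) (\<alpha> \<delta>)) x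
        \<le> N * (2 * (\<alpha> \<delta> * W) + E \<delta>) + 2 * \<delta> + 2 * (\<delta> * W + \<alpha> \<delta> * W)"
    proof eventually_elim
      case (elim \<delta>)
      have a: "0 < \<alpha> \<delta>" using \<alpha>_in[OF elim] by simp
      \<comment> \<open>Exact data are treated as data with noise level \<open>0\<close>.\<close>
      have "psi_SQO q A (\<alpha> \<delta>) y \<le> 2 * \<alpha> \<delta> * W + 2 * 0\<^sup>2 / \<alpha> \<delta>"
        unfolding W_def by (rule psi_SQO_le[OF a w x y2 src y]) simp
      then have p: "psi_SQO q A (\<alpha> \<delta>) y \<le> 2 * (\<alpha> \<delta> * W)" by simp
      have "suminf (data_error (\<alpha> \<delta>) y (z \<delta>)) \<le> N * (\<alpha> \<delta> * (psi_SQO q A (\<alpha> \<delta>) y + E \<delta>))"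
        unfolding N_def E_def
        using noise[OF elim \<alpha>_in[OF elim]] unfolding y_def[symmetric]
        by (rule data_error_le_psi[OF a y2 z(1)[OF elim] C1 C2])
      also have "\<dots> \<le> N * (\<alpha> \<delta> * (2 * (\<alpha> \<delta> * W) + E \<delta>))"
        using p N0 a by (intro mult_left_mono) auto
      finally have "1 / \<alpha> \<delta> * suminf (data_error (\<alpha> \<delta>) y (z \<delta>)) \<le> N * (2 * (\<alpha> \<delta> * W) + E \<delta>)"
        using a by (simp add: field_simps)
      moreover have "bregman (Reg q) (adj A w) (tik_sol q A (z \<delta>) (\<alpha> \<delta>)) x
         \<le> 1 / \<alpha> \<delta> * suminf (data_error (\<alpha> \<delta>) y (z \<delta>)) + 2 * \<delta> + 2 * (\<delta> + \<alpha> \<delta>) * W"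
        unfolding W_def
        by (rule bregman_le_data_error[OF a elim w x z(1)[OF elim] src y dist[OF elim]])
      ultimately show ?case by (simp add: algebra_simps)
    qed
    have "((\<lambda>\<delta>. N * (2 * (\<alpha> \<delta> * W) + E \<delta>) + 2 * \<delta> + 2 * (\<delta> * W + \<alpha> \<delta> * W))
        \<longlongrightarrow> N * (2 * 0 + 0) + 2 * 0 + 2 * (0 * W + 0)) (at_right 0)"
      by (intro tendsto_intros E \<alpha>W)
    then show "((\<lambda>\<delta>. N * (2 * (\<alpha> \<delta> * W) + E \<delta>) + 2 * \<delta> + 2 * (\<delta> * W + \<alpha> \<delta> * W)) \<longlongrightarrow> 0) (at_right 0)"
      by simp
  qed simp
qed

end

theorem theorem8:
  fixes q :: real
  assumes "3 / 2 \<le> q"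
  shows "\<exists>cbar>0.
    \<forall>(lam :: nat \<Rightarrow> real) (A :: rseq \<Rightarrow> rseq) (\<alpha>max :: real) (y :: rseq) (xdag :: rseq) (w :: rseq)
      (yd :: real \<Rightarrow> rseq) (\<alpha>s :: real \<Rightarrow> real) (C1 :: real) (C2 :: real) (C3 :: real).
      (\<forall>n. lam n > 0) \<longrightarrow> decseq lam \<longrightarrow> lam \<longlonglongrightarrow> 0 \<longrightarrow>
      bounded_operator q A \<longrightarrow>
      (\<forall>n. A (std_basis n) = (\<lambda>k. lam n * std_basis n k)) \<longrightarrow>
      \<alpha>max > 0 \<longrightarrow>
      y \<in> lp 2 \<longrightarrow>
      R_minimising_solution q A y xdag \<longrightarrow>
      w \<in> lp 2 \<longrightarrow>
      adj A w \<in> subdifferential q (Reg q) xdag \<longrightarrow>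
      (\<forall>\<delta>>0. yd \<delta> \<in> lp 2 \<and> lp_norm 2 (\<lambda>n. yd \<delta> n - y n) \<le> \<delta>) \<longrightarrow>
      (\<forall>\<delta>>0. is_arg_min (\<lambda>\<alpha>. psi_SQO q A \<alpha> (yd \<delta>)) (\<lambda>\<alpha>. \<alpha> \<in> {0<..<\<alpha>max}) (\<alpha>s \<delta>)) \<longrightarrow>
      (\<forall>\<delta>>0. lp_norm 2 (\<lambda>n. A (tik_sol q A (yd \<delta>) (\<alpha>s \<delta>)) n - yd \<delta> n) \<noteq> 0) \<longrightarrow>
      0 < C1 \<longrightarrow> C1 \<le> cbar \<longrightarrow> 0 < C2 \<longrightarrow> 0 < C3 \<longrightarrow>
      (\<forall>\<delta>>0. \<forall>\<alpha>\<in>{0<..<\<alpha>max}. noise_condition q lam A y (yd \<delta>) \<alpha> C1 C2 C3) \<longrightarrow>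
      ((\<lambda>\<delta>. bregman (Reg q) (adj A w) (tik_sol q A (yd \<delta>) (\<alpha>s \<delta>)) xdag) \<longlongrightarrow> 0) (at_right 0)"
\<comment> \<open>The threshold is the bound on \<open>r\<close> in \<open>quasi_opt_ge\<close>,
  which depends on \<open>q\<close> alone.\<close>
proof (intro exI[of _ "small_threshold (q - 1)"] conjI allI impI)
  show "0 < small_threshold (q - 1)" by (simp add: small_threshold_def)
next
  fix lam :: "nat \<Rightarrow> real" and A :: "rseq \<Rightarrow> rseq" and \<alpha>max :: real and y xdag w :: rseq
    and yd :: "real \<Rightarrow> rseq" and \<alpha>s :: "real \<Rightarrow> real" and C1 C2 C3 :: real
  assume lam: "\<forall>n. lam n > 0" and A: "bounded_operator q A"
    "\<forall>n. A (std_basis n) = (\<lambda>k. lam n * std_basis n k)"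
    and \<alpha>max: "\<alpha>max > 0" and x: "R_minimising_solution q A y xdag" and w: "w \<in> lp 2"
    and sub: "adj A w \<in> subdifferential q (Reg q) xdag"
    and yd: "\<forall>\<delta>>0. yd \<delta> \<in> lp 2 \<and> lp_norm 2 (\<lambda>n. yd \<delta> n - y n) \<le> \<delta>"
    and \<alpha>s: "\<forall>\<delta>>0. is_arg_min (\<lambda>\<alpha>. psi_SQO q A \<alpha> (yd \<delta>)) (\<lambda>\<alpha>. \<alpha> \<in> {0<..<\<alpha>max}) (\<alpha>s \<delta>)"
    and C: "0 < C1" "C1 \<le> small_threshold (q - 1)" "0 < C2"
    and noise: "\<forall>\<delta>>0. \<forall>\<alpha>\<in>{0<..<\<alpha>max}. noise_condition q lam A y (yd \<delta>) \<alpha> C1 C2 C3"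
  interpret diagonal_operator q lam A
    using assms lam A by unfold_locales auto
  have xdag: "xdag \<in> lp q" "A xdag = y"
    using x by (auto simp: R_minimising_solution_def is_arg_min_def)
  show "((\<lambda>\<delta>. bregman (Reg q) (adj A w) (tik_sol q A (yd \<delta>) (\<alpha>s \<delta>)) xdag) \<longlongrightarrow> 0) (at_right 0)"
    by (rule heuristic_convergence[of xdag w \<alpha>max yd \<alpha>s C1 C2 C3, OF xdag(1) w sub \<alpha>max])
      (use yd \<alpha>s C noise in \<open>auto simp: xdag(2)\<close>)
qed

end
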